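(* Let $\mathbb{Z}[\mathbb{C}^*-\{1\}]$ be the free abelian group on symbols $\{x\}$, $x\in\mathbb{C}^*-\{1\}$, and let $$p_2(\{x\}):=\tfrac12\log(1-x)\wedge\log x+2\pi i\wedge\frac{1}{2\pi i}\mathrm{L}_2(x)\in\Lambda^2\mathbb{C},\qquad \mathrm{L}_2(x):=\mathrm{Li}_2(x)+\tfrac12\log(1-x)\log x+\frac{(2\pi i)^2}{24},$$ where $\mathrm{Li}_2(x)$, $\log(1-x)$, $\log x$ are computed by integration along one and the same path from $0$ to $x$. Then: (i) The map $p_2$ is well defined on $\mathbb{Z}[\mathbb{C}^*-\{1\}]$, i.e. $p_2(\{x\})$ does not depend on the choice of the path from $0$ to $x$. (ii) The map $p_2$ sends the five term relations to zero: for any five distinct points $s_1,\dots,s_5\in\mathbb{P}^1(\mathbb{C})$, $$p_2\Bigl(\sum_{i=1}^5(-1)^i\{r(s_1,\dots,\widehat{s_i},\dots,s_5)\}\Bigr)=0 .$$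
   Context: $\Lambda^2\mathbb{C}$ is the exterior square of the abelian group $\mathbb{C}$ (over $\mathbb{Z}$, equivalently over $\mathbb{Q}$). For a path $\gamma$ in $\mathbb{C}-\{0,1\}$ from $0$ to $x$ (starting at the tangential base point at $0$ given by the unit tangent vector dual to $dt$): $$-\log(1-x)=\int_0^x\frac{dt}{1-t},\qquad \log x=\int_0^x\frac{dt}{t},\qquad \mathrm{Li}_2(x)=\int_0^x\frac{dt}{1-t}\circ\frac{dt}{t}$$ (iterated integral, so $d\,\mathrm{Li}_2(x)=-\log(1-x)\,d\log x$), where the integral for $\log x$ is regularized using the tangential base point; all integrals are taken along the same $\gamma$. For $|x|<1$ and the straight path, $\mathrm{Li}_2(x)=\sum_{m\ge1}x^m/m^2$ and $-\log(1-x)=\sum_{m\ge1}x^m/m$. The cross-ratio is $r(s_1,s_2,s_3,s_4)=\dfrac{(s_1-s_4)(s_2-s_3)}{(s_1-s_3)(s_2-s_4)}$. *)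

theory Defs
  imports "HOL-Complex_Analysis.Complex_Analysis" "HOL-Library.Poly_Mapping"
begin

type_synonym 'a frag = "'a \<Rightarrow>\<^sub>0 int"

section \<open>The exterior square of an abelian group\<close>

text \<open>
  The exterior square over the integers: the free abelian group on pairs \<open>(a, b)\<close> modulo the
  subgroup generated by the biadditivity and alternation relators.
\<close>

inductive_set ext_relations :: "('a::ab_group_add \<times> 'a) frag set" where
  zero: "0 \<in> ext_relations"
| diff: "u \<in> ext_relations \<Longrightarrow> v \<in> ext_relations \<Longrightarrow> u - v \<in> ext_relations"
| add_left: "frag_of (a + a', b) - frag_of (a, b) - frag_of (a', b) \<in> ext_relations"
| add_right: "frag_of (a, b + b') - frag_of (a, b) - frag_of (a, b') \<in> ext_relations"
| alternating: "frag_of (a, a) \<in> ext_relations"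

lemma ext_relations_uminus: "u \<in> ext_relations \<Longrightarrow> - u \<in> ext_relations"
  using ext_relations.diff[OF ext_relations.zero] by simp

lemma ext_relations_add: "u \<in> ext_relations \<Longrightarrow> v \<in> ext_relations \<Longrightarrow> u + v \<in> ext_relations"
  using ext_relations.diff[OF _ ext_relations_uminus] by fastforce

lemma frag_cmul_diff_right: "frag_cmul k (u - v) = frag_cmul k u - frag_cmul k v"
  by (rule poly_mapping_eqI) (simp add: lookup_minus algebra_simps)

lemma ext_relations_cmul:
  assumes "u \<in> ext_relations"
  shows "frag_cmul k u \<in> ext_relations"
proof (induction k rule: int_induct[where k = 0])
  case base
  show ?case by (simp add: ext_relations.zero)
next
  case (step1 i)
  then show ?case using assms by (simp add: frag_cmul_distrib ext_relations_add)
next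
  case (step2 i)
  then show ?case using assms by (simp add: frag_cmul_diff_distrib ext_relations.diff)
qed

definition ext_rel :: "('a::ab_group_add \<times> 'a) frag \<Rightarrow> ('a \<times> 'a) frag \<Rightarrow> bool"
  where "ext_rel u v \<longleftrightarrow> u - v \<in> ext_relations"

lemma ext_rel_add: "ext_rel u u' \<Longrightarrow> ext_rel v v' \<Longrightarrow> ext_rel (u + v) (u' + v')"
  unfolding ext_rel_def
  using ext_relations_add[of "u - u'" "v - v'"] by (simp add: algebra_simps)

lemma ext_rel_diff: "ext_rel u u' \<Longrightarrow> ext_rel v v' \<Longrightarrow> ext_rel (u - v) (u' - v')"
  unfolding ext_rel_def
  using ext_relations.diff[of "u - u'" "v - v'"] by (simp add: algebra_simps)

lemma ext_rel_uminus: "ext_rel u u' \<Longrightarrow> ext_rel (- u) (- u')"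
  unfolding ext_rel_def
  using ext_relations_uminus[of "u - u'"] by (simp add: algebra_simps)

quotient_type (overloaded) 'a exterior_square = "('a::ab_group_add \<times> 'a) frag" / ext_rel
proof (rule equivpI)
  show "reflp ext_rel"
    by (auto simp: reflp_def ext_rel_def ext_relations.zero)
  show "symp ext_rel"
    by (auto simp: symp_def ext_rel_def dest: ext_relations_uminus)
  show "transp ext_rel"
  proof (rule transpI)
    fix u v w
    assume "ext_rel u v" "ext_rel v w"
    then have "(u - v) + (v - w) \<in> ext_relations"
      unfolding ext_rel_def by (rule ext_relations_add)
    then show "ext_rel u w"
      by (simp add: ext_rel_def)
  qed
qed

instantiation exterior_square :: (ab_group_add) ab_group_add
begin

lift_definition zero_exterior_square :: "'a exterior_square" is 0 .

lift_definition plus_exterior_square ::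
  "'a exterior_square \<Rightarrow> 'a exterior_square \<Rightarrow> 'a exterior_square" is "(+)"
  by (rule ext_rel_add)

lift_definition uminus_exterior_square :: "'a exterior_square \<Rightarrow> 'a exterior_square" is uminus
  by (rule ext_rel_uminus)

lift_definition minus_exterior_square ::
  "'a exterior_square \<Rightarrow> 'a exterior_square \<Rightarrow> 'a exterior_square" is "(-)"
  by (rule ext_rel_diff)

instance
  by standard (transfer; simp add: ext_rel_def ext_relations.zero algebra_simps)+

end

lift_definition ext_cmul :: "int \<Rightarrow> 'a::ab_group_add exterior_square \<Rightarrow> 'a exterior_square"
  is frag_cmul
  unfolding ext_rel_def by (simp flip: frag_cmul_diff_right add: ext_relations_cmul)

lift_definition wedge :: "'a::ab_group_add \<Rightarrow> 'a \<Rightarrow> 'a exterior_square"  (infixr "\<and>\<^sub>Z" 66)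
  is "\<lambda>a b. frag_of (a, b)" .

lemma wedge_add_left: "(a + a') \<and>\<^sub>Z b = a \<and>\<^sub>Z b + a' \<and>\<^sub>Z b"
  by transfer (use ext_relations.add_left in \<open>simp add: ext_rel_def diff_diff_add\<close>)

lemma wedge_add_right: "a \<and>\<^sub>Z (b + b') = a \<and>\<^sub>Z b + a \<and>\<^sub>Z b'"
  by transfer (use ext_relations.add_right in \<open>simp add: ext_rel_def diff_diff_add\<close>)

lemma wedge_self: "a \<and>\<^sub>Z a = 0"
  by transfer (simp add: ext_rel_def ext_relations.alternating)

lemma ext_cmul_zero: "ext_cmul 0 w = 0"
  by transfer (simp add: ext_rel_def ext_relations.zero)

lemma ext_cmul_one: "ext_cmul 1 w = w"
  by transfer (simp add: ext_rel_def ext_relations.zero)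

lemma ext_cmul_add: "ext_cmul (j + k) w = ext_cmul j w + ext_cmul k w"
  by transfer (simp add: frag_cmul_distrib ext_rel_def ext_relations.zero)

section \<open>Integrals along paths from the tangential base point at 0\<close>

text \<open>
  Paths in \<open>\<complex> - {0,1}\<close> from the unit tangent vector at 0 to \<open>x\<close>: the path leaves 0 with
  velocity exactly 1, and avoids 0 and 1 at all later times.
\<close>

definition tangential_path :: "(real \<Rightarrow> complex) \<Rightarrow> complex \<Rightarrow> bool" where
  "tangential_path \<gamma> x \<longleftrightarrow>
     valid_path \<gamma> \<and> pathstart \<gamma> = 0 \<and> pathfinish \<gamma> = x \<and>
     (\<gamma> has_vector_derivative 1) (at 0 within {0..1}) \<and>
     (\<forall>t\<in>{0<..1}. \<gamma> t \<noteq> 0 \<and> \<gamma> t \<noteq> 1)"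

text \<open>The iterated integral \<open>\<integral> f dt \<circ> g dt\<close>, where the form \<open>f dt\<close> is integrated first.\<close>

definition iterated_integral ::
    "(real \<Rightarrow> complex) \<Rightarrow> (complex \<Rightarrow> complex) \<Rightarrow> (complex \<Rightarrow> complex) \<Rightarrow> complex" where
  "iterated_integral \<gamma> f g =
     integral {0..1} (\<lambda>s. contour_integral (subpath 0 s \<gamma>) f *
                          (g (\<gamma> s) * vector_derivative \<gamma> (at s within {0..1})))"

definition log1m_along :: "(real \<Rightarrow> complex) \<Rightarrow> complex" where
  "log1m_along \<gamma> = - contour_integral \<gamma> (\<lambda>t. 1 / (1 - t))"

text \<open>
  The integral of \<open>dt/t\<close> diverges at 0. Its regularization is the constant term of the
  asymptotic expansion of the integral over \<open>[\<epsilon>, 1]\<close> as a polynomial in \<open>ln \<epsilon>\<close>; as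
  \<open>\<gamma> \<epsilon> = \<epsilon> + o(\<epsilon>)\<close>, this expansion is \<open>- ln \<epsilon> + const + o(1)\<close>.
\<close>

definition log_along :: "(real \<Rightarrow> complex) \<Rightarrow> complex" where
  "log_along \<gamma> =
     Lim (at_right 0) (\<lambda>\<epsilon>. contour_integral (subpath \<epsilon> 1 \<gamma>) (\<lambda>t. 1 / t) + of_real (ln \<epsilon>))"

definition Li2_along :: "(real \<Rightarrow> complex) \<Rightarrow> complex" where
  "Li2_along \<gamma> = iterated_integral \<gamma> (\<lambda>t. 1 / (1 - t)) (\<lambda>t. 1 / t)"

definition L2_along :: "(real \<Rightarrow> complex) \<Rightarrow> complex" where
  "L2_along \<gamma> = Li2_along \<gamma> + 1/2 * log1m_along \<gamma> * log_along \<gamma> + (2 * of_real pi * \<i>)^2 / 24"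

section \<open>The map \<open>p\<^sub>2\<close>\<close>

text \<open>
  The factor 1/2 acts on the exterior square (a rational vector space) through the first argument
  of the wedge.
\<close>

definition p2_along :: "(real \<Rightarrow> complex) \<Rightarrow> complex exterior_square" where
  "p2_along \<gamma> =
     (1/2 * log1m_along \<gamma>) \<and>\<^sub>Z log_along \<gamma> +
     (2 * of_real pi * \<i>) \<and>\<^sub>Z (1 / (2 * of_real pi * \<i>) * L2_along \<gamma>)"

text \<open>
  The value on a symbol is computed along an arbitrarily chosen path; it is meaningful only
  for \<open>x \<notin> {0,1}\<close>. The group \<open>\<int>[\<complex>\<^sup>* - {1}]\<close> consists of the \<open>c :: complex frag\<close> with
  \<open>Poly_Mapping.keys c \<subseteq> - {0,1}\<close>, and \<open>frag_of x\<close> is the symbol \<open>{x}\<close>.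
\<close>

definition p2_symbol :: "complex \<Rightarrow> complex exterior_square" where
  "p2_symbol x = p2_along (SOME \<gamma>. tangential_path \<gamma> x)"

definition p2 :: "complex frag \<Rightarrow> complex exterior_square" where
  "p2 c = (\<Sum>x\<in>Poly_Mapping.keys c. ext_cmul (Poly_Mapping.lookup c x) (p2_symbol x))"

lemma p2_frag_of: "p2 (frag_of x) = p2_symbol x"
  by (simp add: p2_def ext_cmul_one)

lemma p2_superset:
  assumes "finite A" "Poly_Mapping.keys c \<subseteq> A"
  shows "p2 c = (\<Sum>x\<in>A. ext_cmul (Poly_Mapping.lookup c x) (p2_symbol x))"
  unfolding p2_def
  by (rule sum.mono_neutral_left) (use assms in \<open>auto simp: in_keys_iff ext_cmul_zero\<close>)

lemma p2_add: "p2 (c + d) = p2 c + p2 d"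
proof -
  let ?A = "Poly_Mapping.keys c \<union> Poly_Mapping.keys d"
  have "p2 (c + d) = (\<Sum>x\<in>?A. ext_cmul (Poly_Mapping.lookup (c + d) x) (p2_symbol x))"
    by (rule p2_superset) (auto dest: subsetD[OF Poly_Mapping.keys_add])
  also have "\<dots> = p2 c + p2 d"
    by (simp add: p2_superset[of ?A] lookup_add ext_cmul_add sum.distrib)
  finally show ?thesis .
qed

section \<open>Cross-ratios on the projective line\<close>

datatype projective_line = Fin complex | Infty

text \<open>
  The difference \<open>a - b\<close> as the determinant of the homogeneous coordinates \<open>(a, 1)\<close>, \<open>(b, 1)\<close>,
  where the point at infinity has coordinates \<open>(1, 0)\<close>. With this, the formula for the cross-ratio
  makes sense for points at infinity.
\<close>

fun hom_coords :: "projective_line \<Rightarrow> complex \<times> complex" where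
  "hom_coords (Fin a) = (a, 1)"
| "hom_coords Infty = (1, 0)"

definition pdiff :: "projective_line \<Rightarrow> projective_line \<Rightarrow> complex" where
  "pdiff s t = fst (hom_coords s) * snd (hom_coords t) - fst (hom_coords t) * snd (hom_coords s)"

definition cross_ratio ::
    "projective_line \<Rightarrow> projective_line \<Rightarrow> projective_line \<Rightarrow> projective_line \<Rightarrow> complex" where
  "cross_ratio s1 s2 s3 s4 = (pdiff s1 s4 * pdiff s2 s3) / (pdiff s1 s3 * pdiff s2 s4)"

lemma cross_ratio_Fin:
  "cross_ratio (Fin a) (Fin b) (Fin c) (Fin d) = ((a - d) * (b - c)) / ((a - c) * (b - d))"
  by (simp add: cross_ratio_def pdiff_def)

lemma pdiff_eq_0_iff: "pdiff s t = 0 \<longleftrightarrow> s = t"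
  by (cases s; cases t) (auto simp: pdiff_def)

lemma cross_ratio_not_0_1:
  assumes "distinct [s1, s2, s3, s4]"
  shows "cross_ratio s1 s2 s3 s4 \<notin> {0, 1}"
proof -
  have nz: "pdiff s1 s4 \<noteq> 0" "pdiff s2 s3 \<noteq> 0" "pdiff s1 s3 \<noteq> 0" "pdiff s2 s4 \<noteq> 0"
    "pdiff s1 s2 \<noteq> 0" "pdiff s3 s4 \<noteq> 0"
    using assms by (auto simp: pdiff_eq_0_iff)
  have "pdiff s1 s3 * pdiff s2 s4 - pdiff s1 s4 * pdiff s2 s3 = pdiff s1 s2 * pdiff s3 s4"
    unfolding pdiff_def by algebra
  with nz show ?thesis
    by (auto simp: cross_ratio_def)
qed

end

theory Submission
  imports Defs "HOL-Real_Asymp.Real_Asymp"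
begin

text \<open>
  Idea: no homotopy theory of \<open>\<complex> - {0,1}\<close> is needed. The number
  \<open>L\<^sub>2\<close> modulo \<open>(2 \<pi> i)\<^sup>2 / 24 \<int>\<close> is a function of the two logarithms
  \<open>a = log x\<close> and \<open>b = log (1 - x)\<close> alone, given by an explicit formula in the principal
  dilogarithm on \<open>\<complex> - [1, \<infinity>)\<close>, and by the reflected formula on \<open>\<complex> - (-\<infinity>, 0]\<close>; the
  two formulas agree because the reflection constant \<open>\<pi>\<^sup>2 / 6\<close> and the products of periods
  lie in \<open>(2 \<pi> i)\<^sup>2 / 24 \<int>\<close>. Along a path, \<open>L\<^sub>2\<close> follows this function because the
  difference is locally constant. Changing \<open>a\<close> and \<open>b\<close> by periods changes the two summands of
  \<open>p\<^sub>2\<close> by opposite amounts, as \<open>2 \<pi> i \<and> (2 \<pi> i) \<rat> = 0\<close>.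

  For the five term relation, move \<open>s\<^sub>5\<close> to infinity and take all logarithms to be integer
  combinations of logarithms of the differences \<open>s\<^sub>i - s\<^sub>j\<close>. The terms
  \<open>log (1 - r) \<and> log r\<close> then cancel formally, and so do the differentials
  \<open>(log r d log (1 - r) - log (1 - r) d log r) / 2\<close> of the \<open>L\<^sub>2\<close>. Hence the sum of the
  \<open>L\<^sub>2\<close> is constant while \<open>s\<^sub>1\<close> runs to infinity along a ray, where three terms vanish and the
  other two cancel by reflection.
\<close>

section \<open>The principal dilogarithm\<close>

text \<open>The value 1 fills the removable singularity at 0.\<close>

definition dilog_deriv :: "complex \<Rightarrow> complex" where
  "dilog_deriv z = (if z = 0 then 1 else - Ln (1 - z) / z)"

text \<open>Characterised as the primitive vanishing at 0 on the whole plane slit along [1,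
  infinity); the power series would reach only the unit disc. Values on the slit are
  arbitrary.\<close>

definition dilog :: "complex \<Rightarrow> complex" where
  "dilog = (SOME f. f 0 = 0 \<and>
     (\<forall>z. 1 - z \<notin> \<real>\<^sub>\<le>\<^sub>0 \<longrightarrow> (f has_field_derivative dilog_deriv z) (at z)))"

text \<open>The plane slit along the nonpositive reals is star-shaped about every positive real
  \<open>c\<close>. It serves for star centre 0 (\<open>c = 1\<close>) in the construction of
  \<open>dilog\<close> and for star centre 1/2 in the reflection formula.\<close>

lemma segment_pos_not_nonpos_Reals:
  assumes "u \<notin> \<real>\<^sub>\<le>\<^sub>0" "c > 0" "0 \<le> t" "t \<le> 1"
  shows "complex_of_real ((1 - t) * c) + complex_of_real t * u \<notin> \<real>\<^sub>\<le>\<^sub>0"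
proof (cases "t = 0 \<or> Im u \<noteq> 0")
  case True
  then show ?thesis using assms by (cases "t = 0") (auto simp: complex_nonpos_Reals_iff)
next
  case False
  with assms have "Re u > 0" "t > 0" by (auto simp: complex_nonpos_Reals_iff)
  then have "(1 - t) * c + t * Re u > 0"
    using assms by (intro add_nonneg_pos mult_nonneg_nonneg mult_pos_pos) auto
  then show ?thesis by (simp add: complex_nonpos_Reals_iff)
qed

lemma open_slit_plane: "open {z::complex. 1 - z \<notin> \<real>\<^sub>\<le>\<^sub>0}"
proof -
  have "open ((\<lambda>z. 1 - z) -` (- \<real>\<^sub>\<le>\<^sub>0) :: complex set)"
    by (intro open_vimage continuous_intros) (simp add: closed_nonpos_Reals_complex)
  then show ?thesis by (simp add: vimage_def)
qed

lemma has_field_derivative_Ln_one_minus: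
  "1 - z \<notin> \<real>\<^sub>\<le>\<^sub>0 \<Longrightarrow> ((\<lambda>z. Ln (1 - z)) has_field_derivative - inverse (1 - z)) (at z)"
  by (auto intro!: derivative_eq_intros)

lemma continuous_dilog_deriv: "isCont dilog_deriv 0"
proof -
  have "((\<lambda>z. Ln (1 - z)) has_field_derivative -1) (at 0)"
    using has_field_derivative_Ln_one_minus[of 0] by (simp add: complex_nonpos_Reals_iff)
  then have "(\<lambda>h. Ln (1 - h) / h) \<midarrow>0\<rightarrow> -1"
    by (simp add: DERIV_def)
  then have "(\<lambda>h. - (Ln (1 - h) / h)) \<midarrow>0\<rightarrow> 1"
    using tendsto_minus by fastforce
  then have "dilog_deriv \<midarrow>0\<rightarrow> 1"
    by (rule Lim_transform_eventually) (auto simp: eventually_at dilog_deriv_def intro!: exI[of _ 1])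
  then show ?thesis by (simp add: isCont_def dilog_deriv_def)
qed

lemma field_differentiable_dilog_deriv:
  assumes "1 - z \<notin> \<real>\<^sub>\<le>\<^sub>0" "z \<noteq> 0"
  shows "dilog_deriv field_differentiable at z"
proof -
  have "((\<lambda>w. - Ln (1 - w) / w) has_field_derivative
      - ((- (inverse (1 - z) * z) - Ln (1 - z)) / (z * z))) (at z)"
    using assms by (auto intro!: derivative_eq_intros)
  moreover have "\<forall>\<^sub>F w in nhds z. w \<noteq> 0"
    using assms(2) by (intro t1_space_nhds) auto
  then have "\<forall>\<^sub>F w in nhds z. - Ln (1 - w) / w = dilog_deriv w"
    by eventually_elim (simp add: dilog_deriv_def)
  ultimately show ?thesis
    unfolding field_differentiable_def
    by (intro exI) (rule iffD1[OF DERIV_cong_ev[OF refl _ refl]])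
qed

lemma dilog_exists:
  "\<exists>f. f 0 = 0 \<and> (\<forall>z. 1 - z \<notin> \<real>\<^sub>\<le>\<^sub>0 \<longrightarrow> (f has_field_derivative dilog_deriv z) (at z))"
proof -
  let ?S = "{z::complex. 1 - z \<notin> \<real>\<^sub>\<le>\<^sub>0}"
  have "starlike ?S"
    unfolding starlike_def
  proof (intro bexI ballI subsetI)
    fix z w assume "z \<in> ?S" "w \<in> closed_segment 0 z"
    then obtain t where "w = of_real t * z" "0 \<le> t" "t \<le> 1"
      by (auto simp: in_segment scaleR_conv_of_real)
    then show "w \<in> ?S"
      using segment_pos_not_nonpos_Reals[of "1 - z" 1 t] \<open>z \<in> ?S\<close> by (simp add: algebra_simps)
  qed (simp add: complex_nonpos_Reals_iff)
  moreover have "continuous_on ?S dilog_deriv"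
    by (intro continuous_at_imp_continuous_on)
      (use continuous_dilog_deriv field_differentiable_dilog_deriv
        field_differentiable_imp_continuous_at in blast)
  \<comment> \<open>At the exceptional point 0 continuity is enough for the existence of a
    primitive.\<close>
  ultimately obtain g where g: "\<forall>z\<in>?S. (g has_field_derivative dilog_deriv z) (at z)"
    using holomorphic_starlike_primitive[of ?S dilog_deriv "{0}"] open_slit_plane
      field_differentiable_dilog_deriv by auto
  show ?thesis
    by (rule exI[of _ "\<lambda>z. g z - g 0"]) (use g in \<open>auto intro!: derivative_eq_intros\<close>)
qed

lemma dilog_0 [simp]: "dilog 0 = 0"
  and has_field_derivative_dilog:
    "1 - z \<notin> \<real>\<^sub>\<le>\<^sub>0 \<Longrightarrow> (dilog has_field_derivative dilog_deriv z) (at z)"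
  using someI_ex[OF dilog_exists] unfolding dilog_def[symmetric] by auto

lemma isCont_dilog: "1 - z \<notin> \<real>\<^sub>\<le>\<^sub>0 \<Longrightarrow> isCont dilog z"
  by (rule DERIV_isCont[OF has_field_derivative_dilog])

section \<open>Boundary value at 1 and the reflection formula\<close>

text \<open>Termwise differentiation gives \<open>dilog_deriv\<close>, and both sides vanish at 0.
  The series serves to compute the limit at 1.\<close>

lemma dilog_series:
  assumes "norm z < 1"
  shows "dilog z = suminf (\<lambda>n. 1 / (of_nat n)\<^sup>2 * z ^ n)"
proof -
  \<comment> \<open>The coefficient for \<open>n = 0\<close> is \<open>1 / 0 = 0\<close>, so
    summation over all naturals starts in effect at 1.\<close>
  let ?c = "\<lambda>n. 1 / (complex_of_nat n)\<^sup>2"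
  let ?h = "\<lambda>z. suminf (\<lambda>n. ?c n * z ^ n)"
  have smm: "summable (\<lambda>n. ?c n * w ^ n)" if "norm w < 1" for w
  proof (rule summable_comparison_test[OF _ summable_geometric[of "norm w"]])
    have "norm (?c n * w ^ n) \<le> norm w ^ n" for n
    proof (cases n)
      case (Suc m)
      have "norm (?c n) \<le> 1"
        using Suc by (simp add: norm_divide norm_power del: of_nat_Suc)
      then show ?thesis
        by (simp only: norm_mult norm_power) (simp add: mult_left_le_one_le del: norm_divide)
    qed simp
    then show "\<exists>N. \<forall>n\<ge>N. norm (?c n * w ^ n) \<le> norm w ^ n" by blast
  qed (use that in simp)
  have der: "(?h has_field_derivative dilog_deriv w) (at w)" if w: "norm w < 1" for w
  proof -
    have 1: "(?h has_field_derivative (suminf (\<lambda>n. diffs ?c n * w ^ n))) (at w)"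
      by (rule termdiffs_strong'[of 1]) (use w smm in auto)
    have d: "diffs ?c n = 1 / of_nat (Suc n)" for n
      by (simp add: diffs_def power2_eq_square del: of_nat_Suc)
    have "(\<lambda>n. - ((- (-w))^n) / of_nat n) sums ln (1 + (-w))"
      using Ln_series'[of "-w"] w by simp
    then have "(\<lambda>n. - (w ^ Suc n / of_nat (Suc n))) sums ln (1 - w)"
      using sums_Suc_iff[of "\<lambda>n. - (w ^ n) / of_nat n" "ln (1 - w)"] by (simp del: of_nat_Suc)
    then have s: "(\<lambda>n. w ^ Suc n / of_nat (Suc n)) sums (- ln (1 - w))"
      using sums_minus by fastforce
    have "(suminf (\<lambda>n. diffs ?c n * w ^ n)) = dilog_deriv w"
    proof (cases "w = 0")
      case True
      then show ?thesis by (simp only: powser_zero d) (simp add: dilog_deriv_def)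
    next
      case False
      from sums_divide[OF s, of w] have "(\<lambda>n. diffs ?c n * w ^ n) sums (- ln (1 - w) / w)"
        using False by (simp add: d field_simps del: of_nat_Suc)
      then show ?thesis using False by (simp add: dilog_deriv_def sums_iff)
    qed
    with 1 show ?thesis by simp
  qed
  have "\<exists>c. \<forall>w\<in>ball 0 1. ?h w - dilog w = c"
  proof (rule has_field_derivative_zero_constant)
    fix w :: complex assume "w \<in> ball 0 1"
    then have w: "norm w < 1" by simp
    then have "1 - w \<notin> \<real>\<^sub>\<le>\<^sub>0"
      using complex_Re_le_cmod[of w] by (auto simp: complex_nonpos_Reals_iff)
    from DERIV_diff[OF der[OF w] has_field_derivative_dilog[OF this]]
    show "((\<lambda>w. ?h w - dilog w) has_field_derivative 0) (at w within ball 0 1)"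
      by (simp add: has_field_derivative_at_within)
  qed simp
  then obtain c where c: "\<And>w. norm w < 1 \<Longrightarrow> ?h w - dilog w = c" by auto
  from c[of 0] have "c = 0" by (simp only: powser_zero) simp
  with c[OF assms] show ?thesis by simp
qed

text \<open>The majorant \<open>1 / n^2\<close> makes the series converge uniformly on [0, 1], so
  its sum is continuous up to 1, where it is the Basel sum.\<close>

lemma tendsto_dilog_1: "((\<lambda>x. dilog (of_real x)) \<longlongrightarrow> of_real (pi\<^sup>2 / 6)) (at_left 1)"
proof -
  let ?f = "\<lambda>n (x::real). 1 / (of_nat n)\<^sup>2 * x ^ n"
  have basel: "(\<lambda>n. 1 / (real n)\<^sup>2) sums (pi\<^sup>2 / 6)"
    using inverse_squares_sums sums_Suc_iff[of "\<lambda>n. 1 / (real n)\<^sup>2"] by simp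
  have "uniform_limit {0..1} (\<lambda>n x. \<Sum>i<n. ?f i x) (\<lambda>x. suminf (\<lambda>i. ?f i x)) sequentially"
  proof (rule Weierstrass_m_test)
    show "norm (?f n x) \<le> 1 / (real n)\<^sup>2" if "x \<in> {0..1}" for n x
      using that by (simp add: abs_mult power_le_one mult_left_le divide_right_mono)
  qed (use basel in \<open>simp add: sums_iff\<close>)
  then have "continuous_on {0..1} (\<lambda>x. suminf (\<lambda>i. ?f i x))"
    by (rule uniform_limit_theorem[rotated])
      (intro eventuallyI continuous_on_sum continuous_on_mult_left continuous_on_power
        continuous_on_id trivial_limit_sequentially)+
  then have "((\<lambda>x. suminf (\<lambda>i. ?f i x)) \<longlongrightarrow> (suminf (\<lambda>i. ?f i 1))) (at 1 within {0..1})"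
    unfolding continuous_on by (rule bspec) simp
  then have lim: "((\<lambda>x. suminf (\<lambda>i. ?f i x)) \<longlongrightarrow> pi\<^sup>2 / 6) (at_left 1)"
    using sums_unique[OF basel] by (simp add: at_within_Icc_at_left)
  have "\<forall>\<^sub>F x in at_left 1. x \<in> {0<..<1::real}"
    by (rule eventually_at_left_real) simp
  then have "\<forall>\<^sub>F x in at_left 1. of_real (suminf (\<lambda>i. ?f i x)) = dilog (of_real x)"
  proof eventually_elim
    case (elim x)
    then have x: "0 \<le> x" "x \<le> 1" by auto
    have "summable (\<lambda>i. ?f i x)"
      by (rule summable_comparison_test[OF _ sums_summable[OF basel]])
        (use x in \<open>auto simp: abs_mult power_le_one mult_left_le divide_right_mono\<close>)
    then have "of_real (suminf (\<lambda>i. ?f i x)) = suminf (\<lambda>i. complex_of_real (?f i x))"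
      by (rule suminf_of_real)
    also have "\<dots> = dilog (of_real x)"
      using elim by (subst dilog_series) auto
    finally show ?case .
  qed
  with tendsto_of_real[OF lim] show ?thesis
    by (rule Lim_transform_eventually)
qed

text \<open>The derivative vanishes on the doubly slit plane, which is star-shaped about 1/2 and
  hence connected. The constant is read off as z tends to 1 along the reals: there
  \<open>dilog (1 - z)\<close> and the product of logarithms tend to 0.\<close>

theorem dilog_reflection:
  assumes "z \<notin> \<real>\<^sub>\<le>\<^sub>0" "1 - z \<notin> \<real>\<^sub>\<le>\<^sub>0"
  shows "dilog z + dilog (1 - z) + Ln z * Ln (1 - z) = of_real (pi\<^sup>2 / 6)"
proof -
  let ?W = "{z::complex. z \<notin> \<real>\<^sub>\<le>\<^sub>0 \<and> 1 - z \<notin> \<real>\<^sub>\<le>\<^sub>0}"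
  let ?f = "\<lambda>z. dilog z + dilog (1 - z) + Ln z * Ln (1 - z)"
  have W: "?W = - \<real>\<^sub>\<le>\<^sub>0 \<inter> {z. 1 - z \<notin> \<real>\<^sub>\<le>\<^sub>0}" by auto
  have op: "open ?W"
    unfolding W by (intro open_Int open_slit_plane) (simp add: closed_nonpos_Reals_complex open_Compl)
  have "starlike ?W"
    unfolding starlike_def
  proof (intro bexI ballI subsetI)
    fix z w assume "z \<in> ?W" "w \<in> closed_segment (1/2) z"
    then obtain t where w: "w = of_real ((1 - t) * (1/2)) + of_real t * z" and "0 \<le> t" "t \<le> 1"
      by (auto simp: in_segment scaleR_conv_of_real)
    moreover from w have "1 - w = of_real ((1 - t) * (1/2)) + of_real t * (1 - z)"
      by (simp add: field_simps)
    ultimately show "w \<in> ?W"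
      using segment_pos_not_nonpos_Reals[of "1 - z" "1/2" t]
        segment_pos_not_nonpos_Reals[of z "1/2" t] \<open>z \<in> ?W\<close>
      by (metis (mono_tags, lifting) half_gt_zero_iff mem_Collect_eq zero_less_one)
  qed (simp add: complex_nonpos_Reals_iff)
  then have con: "connected ?W" by (rule starlike_imp_connected)
  have "(?f has_field_derivative 0) (at z)" if z: "z \<in> ?W" for z
  proof -
    have nz: "z \<noteq> 0" "z \<noteq> 1" using z by (auto simp: complex_nonpos_Reals_iff)
    have d: "((\<lambda>z. dilog (1 - z)) has_field_derivative dilog_deriv (1 - z) * (-1)) (at z)"
      by (rule DERIV_chain2[OF has_field_derivative_dilog])
        (use z in \<open>auto intro!: derivative_eq_intros\<close>)
    have "(?f has_field_derivative dilog_deriv z + dilog_deriv (1 - z) * (-1)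
        + (inverse z * Ln (1 - z) + - inverse (1 - z) * Ln z)) (at z)"
      using z nz by (intro DERIV_add DERIV_mult d has_field_derivative_dilog
          has_field_derivative_Ln has_field_derivative_Ln_one_minus) auto
    then show ?thesis
      using nz by (simp add: dilog_deriv_def divide_inverse)
  qed
  then obtain c where c: "\<And>z. z \<in> ?W \<Longrightarrow> ?f z = c"
    using DERIV_zero_connected_constant[OF con op finite.emptyI, of ?f]
    by (metis (no_types, lifting) Diff_empty DERIV_isCont continuous_at_imp_continuous_on)
  have ev: "\<forall>\<^sub>F x in at_left 1. x \<in> {0<..<1::real}"
    by (rule eventually_at_left_real) simp
  have "((\<lambda>x. ?f (of_real x)) \<longlongrightarrow> of_real (pi\<^sup>2 / 6) + 0 + of_real 0) (at_left (1::real))"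
  proof (intro tendsto_add tendsto_dilog_1)
    have "((\<lambda>x. 1 - complex_of_real x) \<longlongrightarrow> 1 - of_real 1) (at_left 1)"
      by (intro tendsto_intros)
    then have "((\<lambda>x. dilog (1 - of_real x)) \<longlongrightarrow> dilog 0) (at_left (1::real))"
      by (intro isCont_tendsto_compose[OF isCont_dilog]) (auto simp: complex_nonpos_Reals_iff)
    then show "((\<lambda>x. dilog (1 - of_real x)) \<longlongrightarrow> 0) (at_left (1::real))" by simp
    have "((\<lambda>x::real. ln x * ln (1 - x)) \<longlongrightarrow> 0) (at_left 1)" by real_asymp
    then have "((\<lambda>x::real. complex_of_real (ln x * ln (1 - x))) \<longlongrightarrow> of_real 0) (at_left 1)"
      by (rule tendsto_of_real)
    moreover have "\<forall>\<^sub>F x in at_left 1.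
        complex_of_real (ln x * ln (1 - x)) = Ln (of_real x) * Ln (1 - of_real x)"
      using ev
    proof eventually_elim
      case (elim x)
      then have "Ln (complex_of_real (1 - x)) = of_real (ln (1 - x))"
        by (intro Ln_of_real) auto
      with elim show ?case by (simp add: Ln_of_real)
    qed
    ultimately show "((\<lambda>x::real. Ln (of_real x) * Ln (1 - of_real x)) \<longlongrightarrow> of_real 0) (at_left 1)"
      by (rule Lim_transform_eventually)
  qed
  moreover have "\<forall>\<^sub>F x in at_left 1. ?f (of_real x) = c"
    using ev by eventually_elim (rule c, simp add: complex_nonpos_Reals_iff)
  ultimately have "((\<lambda>x. c) \<longlongrightarrow> of_real (pi\<^sup>2 / 6)) (at_left (1::real))"
    by (simp add: tendsto_cong)
  then have "c = of_real (pi\<^sup>2 / 6)"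
    by (simp add: tendsto_const_iff)
  with c[of z] assms show ?thesis by simp
qed

section \<open>The dilogarithm as a function of two logarithms\<close>

definition rogers_exp :: "complex \<Rightarrow> complex \<Rightarrow> complex" where
  "rogers_exp a b = exp (12 / (of_real pi * \<i>) * (dilog (exp a) + Ln (exp b) * a - a * b / 2))"

text \<open>
  For \<open>exp a + exp b = 1\<close> this is \<open>exp (24 L\<^sub>2 / (2 \<pi> i))\<close>. The factor 24 kills the
  ambiguity \<open>(2 \<pi> i)\<^sup>2 / 24\<close> coming from the reflection formula.
\<close>

definition ext_rogers :: "complex \<Rightarrow> complex \<Rightarrow> complex" where
  "ext_rogers a b = (if exp b \<notin> \<real>\<^sub>\<le>\<^sub>0 then rogers_exp a b else inverse (rogers_exp b a))"

text \<open>The real parts add up to 1, so one of them is positive. Thus the two formulas in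
  \<open>ext_rogers\<close> cover all cases.\<close>

lemma exp_sum_1_cases:
  assumes "exp a + exp b = (1::complex)"
  obtains "exp a \<notin> \<real>\<^sub>\<le>\<^sub>0" | "exp b \<notin> \<real>\<^sub>\<le>\<^sub>0"
proof -
  have "Re (exp a) + Re (exp b) = 1"
    using assms by (metis complex_Re_numeral complex_eq_iff one_complex.sel(1) plus_complex.sel(1))
  then show ?thesis using that by (force simp: complex_nonpos_Reals_iff)
qed

lemma exp_2pi_i_int_times: "exp (of_int k * (2 * of_real pi * \<i>)) = 1"
  using exp_integer_2pi[of "of_int k"] by (simp add: mult_ac)

lemma Ln_exp_shift: obtains n where "a = Ln (exp a) + of_int n * (2 * of_real pi * \<i>)"
proof -
  have "exp a = exp (Ln (exp a))" by simp
  then obtain n where "a = Ln (exp a) + complex_of_real (real_of_int (2 * n) * pi) * \<i>"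
    unfolding exp_eq by blast
  then show ?thesis by (intro that[of n]) (simp add: algebra_simps)
qed

text \<open>If \<open>a\<close> and \<open>b\<close> exceed the principal logarithms by
  \<open>m\<close> and \<open>n\<close> periods, the two brackets add up to pi^2/6 - (2 pi i)^2 m n.
  Multiplication by 12/(pi i) turns this into the integer multiple -24 m n - 1 of 2 pi i.\<close>

lemma rogers_exp_reflection:
  assumes "exp a + exp b = 1" "exp a \<notin> \<real>\<^sub>\<le>\<^sub>0" "exp b \<notin> \<real>\<^sub>\<le>\<^sub>0"
  shows "rogers_exp a b * rogers_exp b a = 1"
proof -
  obtain m n where a: "a = Ln (exp a) + of_int m * (2 * of_real pi * \<i>)"
    and b: "b = Ln (exp b) + of_int n * (2 * of_real pi * \<i>)"
    using Ln_exp_shift by metis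
  have eb: "1 - exp a = exp b" using assms(1) by (simp add: algebra_simps)
  define A B where "A = Ln (exp a)" and "B = Ln (exp b)"
  have r: "dilog (exp a) + dilog (exp b) = of_real (pi\<^sup>2 / 6) - A * B"
    using dilog_reflection[of "exp a"] assms eb by (simp add: A_def B_def eq_diff_eq)
  have "(dilog (exp a) + B * a - a * b / 2) + (dilog (exp b) + A * b - b * a / 2)
      = of_real (pi\<^sup>2 / 6) - (a - A) * (b - B)"
    using r by (simp add: algebra_simps)
  also have "\<dots> = of_real pi * \<i> / 12 * (of_int (48 * m * n + 2) * of_real pi * -\<i>)"
  proof -
    have "a - A = of_int m * (2 * of_real pi * \<i>)" "b - B = of_int n * (2 * of_real pi * \<i>)"
      using a b by (simp_all add: A_def B_def algebra_simps)
    then show ?thesis by (simp add: algebra_simps power2_eq_square)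
  qed
  finally have "12 / (of_real pi * \<i>) *
      ((dilog (exp a) + B * a - a * b / 2) + (dilog (exp b) + A * b - b * a / 2))
      = of_int (- 24 * m * n - 1) * (2 * of_real pi * \<i>)"
    by (simp add: field_simps)
  then show ?thesis
    unfolding rogers_exp_def exp_add[symmetric] distrib_left[symmetric]
    by (simp only: A_def B_def exp_2pi_i_int_times)
qed

lemma ext_rogers_eq_rogers_exp: "exp b \<notin> \<real>\<^sub>\<le>\<^sub>0 \<Longrightarrow> ext_rogers a b = rogers_exp a b"
  by (simp add: ext_rogers_def)

text \<open>By reflection the second formula also holds where both apply, so the preference given to
  the first one in the definition does not matter.\<close>

lemma ext_rogers_eq_inverse:
  assumes "exp a + exp b = 1" "exp a \<notin> \<real>\<^sub>\<le>\<^sub>0"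
  shows "ext_rogers a b = inverse (rogers_exp b a)"
  using rogers_exp_reflection[OF assms(1,2)]
  by (auto simp: ext_rogers_def inverse_eq_divide eq_divide_eq rogers_exp_def)

lemma ext_rogers_nonzero [simp]: "ext_rogers a b \<noteq> 0"
  by (simp add: ext_rogers_def rogers_exp_def)

lemma ext_rogers_swap:
  assumes "exp a + exp b = 1"
  shows "ext_rogers a b * ext_rogers b a = 1"
  using assms
proof (cases rule: exp_sum_1_cases)
  case 1
  then show ?thesis
    using ext_rogers_eq_inverse[OF assms 1] ext_rogers_eq_rogers_exp[OF 1, of b]
    by (simp add: rogers_exp_def)
next
  case 2
  then show ?thesis
    using ext_rogers_eq_inverse[of b a] ext_rogers_eq_rogers_exp[OF 2, of a] assms
    by (simp add: rogers_exp_def add.commute)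
qed

text \<open>Apart from the part linear in \<open>a\<close> and \<open>b\<close>, the exponent
  changes by products of two periods, which the factor 12/(pi i) turns into integer multiples of 2
  pi i.\<close>

lemma rogers_exp_shift:
  assumes "a' = a + of_int m * (2 * of_real pi * \<i>)" "b' = b + of_int n * (2 * of_real pi * \<i>)"
  shows "rogers_exp a' b' = rogers_exp a b * exp (12 * (of_int m * b - of_int n * a))"
proof -
  obtain k where "b = Ln (exp b) + of_int k * (2 * of_real pi * \<i>)"
    using Ln_exp_shift by blast
  then have B: "Ln (exp b) = b - of_int k * (2 * of_real pi * \<i>)" by (simp add: algebra_simps)
  have e: "exp a' = exp a" "exp b' = exp b"
    using assms exp_2pi_i_int_times by (simp_all add: exp_add)
  have "12 / (of_real pi * \<i>) * (dilog (exp a) + Ln (exp b) * a' - a' * b' / 2)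
      = 12 / (of_real pi * \<i>) * (dilog (exp a) + Ln (exp b) * a - a * b / 2)
        + 12 * (of_int m * b - of_int n * a)
        + of_int (- (12 * m * n) - 24 * k * m) * (2 * of_real pi * \<i>)"
    unfolding B assms by (simp add: field_simps)
  then show ?thesis
    unfolding rogers_exp_def e by (simp only: exp_add exp_2pi_i_int_times mult_1_right)
qed

text \<open>In the second chart \<open>a\<close> and \<open>b\<close> change roles, which reverses
  the sign of the exponent; taking the inverse restores it.\<close>

lemma ext_rogers_shift:
  assumes "exp a + exp b = 1"
    and "a' = a + of_int m * (2 * of_real pi * \<i>)" "b' = b + of_int n * (2 * of_real pi * \<i>)"
  shows "ext_rogers a' b' = ext_rogers a b * exp (12 * (of_int m * b - of_int n * a))"
proof -
  have e: "exp a' = exp a" "exp b' = exp b"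
    using assms exp_2pi_i_int_times by (simp_all add: exp_add)
  show ?thesis
  proof (cases "exp b \<in> \<real>\<^sub>\<le>\<^sub>0")
    case False
    then show ?thesis
      using rogers_exp_shift[OF assms(2,3)] by (simp add: ext_rogers_def e)
  next
    case True
    have "inverse (exp (12 * (of_int n * a - of_int m * b))) =
        exp (12 * (of_int m * b - of_int n * a))"
      by (simp flip: exp_minus add: algebra_simps)
    with True show ?thesis
      using rogers_exp_shift[OF assms(3,2)] by (simp add: ext_rogers_def e)
  qed
qed

section \<open>Derivatives and limits of \<open>ext_rogers\<close>\<close>

lemma has_vector_derivative_field_chain:
  assumes "(g has_field_derivative g') (at (f x))" "(f has_vector_derivative f') (at x within S)"
  shows "((\<lambda>x. g (f x)) has_vector_derivative f' * g') (at x within S)"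
  using field_vector_diff_chain_within[OF assms(2) has_field_derivative_at_within[OF assms(1)]]
  by (simp add: o_def)

text \<open>As 1 - exp a = exp b, the differential of \<open>dilog (exp a)\<close> is -
  \<open>Ln (exp b)\<close> da. It cancels against the product rule term of
  \<open>Ln (exp b) * a\<close>, leaving the branch-free form (a db - b da) / 2.\<close>

lemma has_vector_derivative_rogers_exp:
  assumes a: "(a has_vector_derivative a') (at s within S)"
    and b: "(b has_vector_derivative b') (at s within S)"
    and sum: "exp (a s) + exp (b s) = 1" and slit: "exp (b s) \<notin> \<real>\<^sub>\<le>\<^sub>0"
  shows "((\<lambda>s. rogers_exp (a s) (b s)) has_vector_derivative
    rogers_exp (a s) (b s) * (6 / (of_real pi * \<i>) * (a s * b' - b s * a'))) (at s within S)"
proof -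
  have eb: "1 - exp (a s) = exp (b s)" using sum by (simp add: algebra_simps)
  let ?B = "Ln (exp (b s))"
  have 1: "((\<lambda>w. dilog (exp w)) has_field_derivative - ?B) (at (a s))"
  proof -
    have "((\<lambda>w. dilog (exp w)) has_field_derivative dilog_deriv (exp (a s)) * exp (a s)) (at (a s))"
      by (rule DERIV_chain2[OF has_field_derivative_dilog DERIV_exp]) (simp add: eb slit)
    then show ?thesis by (simp add: dilog_deriv_def eb)
  qed
  have 2: "((\<lambda>w. Ln (exp w)) has_field_derivative 1) (at (b s))"
    using slit by (auto intro!: derivative_eq_intros)
  have d: "((\<lambda>s. dilog (exp (a s)) + Ln (exp (b s)) * a s - a s * b s / 2) has_vector_derivative
      a' * - ?B + (?B * a' + (b' * 1) * a s) - (a s * b' + a' * b s) / 2) (at s within S)"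
    by (intro has_vector_derivative_diff has_vector_derivative_add has_vector_derivative_mult
        has_vector_derivative_divide a b 
        has_vector_derivative_field_chain[where g = "\<lambda>w. dilog (exp w)" and f = a, OF 1]
        has_vector_derivative_field_chain[where g = "\<lambda>w. Ln (exp w)" and f = b, OF 2])
  have "((\<lambda>s. rogers_exp (a s) (b s)) has_vector_derivative
      (a' * - ?B + (?B * a' + (b' * 1) * a s) - (a s * b' + a' * b s) / 2) *
        (rogers_exp (a s) (b s) * (12 / (of_real pi * \<i>)))) (at s within S)"
    unfolding rogers_exp_def
    by (rule has_vector_derivative_field_chain
        [where g = "\<lambda>u. exp (12 / (of_real pi * \<i>) * u)", OF _ d])
      (auto intro!: derivative_eq_intros)
  moreover have "12 / (of_real pi * \<i>) = 2 * (6 / (of_real pi * \<i>))" by simp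
  moreover have "(a' * - ?B + (?B * a' + (b' * 1) * a s) - (a s * b' + a' * b s) / 2) *
      (R * (2 * c)) = R * (c * (a s * b' - b s * a'))" for R c
    by (simp add: field_simps)
  ultimately show ?thesis by (simp only:)
qed

text \<open>The logarithmic derivative is antisymmetric in \<open>a\<close> and \<open>b\<close>,
  hence the same in both charts. The relation is assumed on all of \<open>S\<close> because the
  second formula must agree with \<open>ext_rogers\<close> at nearby points too.\<close>

lemma has_vector_derivative_ext_rogers:
  assumes a: "(a has_vector_derivative a') (at s within S)"
    and b: "(b has_vector_derivative b') (at s within S)"
    and sum: "\<And>t. t \<in> S \<Longrightarrow> exp (a t) + exp (b t) = 1" and s: "s \<in> S"
  shows "((\<lambda>s. ext_rogers (a s) (b s)) has_vector_derivative
    ext_rogers (a s) (b s) * (6 / (of_real pi * \<i>) * (a s * b' - b s * a'))) (at s within S)"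
proof -
  have near: "\<exists>d>0. \<forall>t\<in>S. dist t s < d \<longrightarrow> exp (f t) \<notin> \<real>\<^sub>\<le>\<^sub>0"
    if "(f has_vector_derivative f') (at s within S)" "exp (f s) \<notin> \<real>\<^sub>\<le>\<^sub>0" for f :: "real \<Rightarrow> complex" and f'
  proof -
    have "(f \<longlongrightarrow> f s) (at s within S)"
      using has_vector_derivative_continuous[OF that(1)] by (simp add: continuous_within)
    then have "\<forall>\<^sub>F t in at s within S. exp (f t) \<in> - \<real>\<^sub>\<le>\<^sub>0"
      by (intro topological_tendstoD[OF tendsto_exp])
        (use that(2) in \<open>auto simp: closed_nonpos_Reals_complex open_Compl\<close>)
    then show ?thesis
      using that(2) unfolding eventually_at by (metis ComplD)
  qed
  from sum[OF s] show ?thesis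
  proof (cases rule: exp_sum_1_cases)
    case 1
    have sum': "exp (b s) + exp (a s) = 1" using sum[OF s] by (simp add: add.commute)
    have "((\<lambda>s. inverse (rogers_exp (b s) (a s))) has_vector_derivative
        (rogers_exp (b s) (a s) * (6 / (of_real pi * \<i>) * (b s * a' - a s * b'))) *
        - (inverse (rogers_exp (b s) (a s)) * inverse (rogers_exp (b s) (a s)))) (at s within S)"
      by (rule has_vector_derivative_field_chain[where g = inverse, OF _
            has_vector_derivative_rogers_exp[OF b a sum' 1]])
        (auto intro!: derivative_eq_intros simp: rogers_exp_def)
    moreover have "R * (c * (u - v)) * - (inverse R * inverse R) = inverse R * (c * (v - u))"
      if "R \<noteq> 0" for R c u v :: complex
      using that by (simp add: field_simps)
    moreover have "rogers_exp (b s) (a s) \<noteq> 0" by (simp add: rogers_exp_def)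
    ultimately have D: "((\<lambda>s. inverse (rogers_exp (b s) (a s))) has_vector_derivative
        ext_rogers (a s) (b s) * (6 / (of_real pi * \<i>) * (a s * b' - b s * a'))) (at s within S)"
      unfolding ext_rogers_eq_inverse[OF sum[OF s] 1] by metis
    obtain d where "d > 0" and d: "\<And>t. t \<in> S \<Longrightarrow> dist t s < d \<Longrightarrow> exp (a t) \<notin> \<real>\<^sub>\<le>\<^sub>0"
      using near[OF a 1] by blast
    show ?thesis
      by (rule has_vector_derivative_transform_within[OF D \<open>d > 0\<close> s])
        (simp add: ext_rogers_eq_inverse sum d)
  next
    case 2
    obtain d where "d > 0" and d: "\<And>t. t \<in> S \<Longrightarrow> dist t s < d \<Longrightarrow> exp (b t) \<notin> \<real>\<^sub>\<le>\<^sub>0"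
      using near[OF b 2] by blast
    show ?thesis
      unfolding ext_rogers_eq_rogers_exp[OF 2]
      by (rule has_vector_derivative_transform_within
          [OF has_vector_derivative_rogers_exp[OF a b sum[OF s] 2] \<open>d > 0\<close> s])
        (simp add: ext_rogers_eq_rogers_exp d)
  qed
qed

lemma tendsto_ext_rogers:
  fixes F :: "'a filter"
  assumes a: "(a \<longlongrightarrow> a0) F" and b: "(b \<longlongrightarrow> b0) F"
    and sum: "\<forall>\<^sub>F t in F. exp (a t) + exp (b t) = 1" and sum0: "exp a0 + exp b0 = 1"
  shows "((\<lambda>t. ext_rogers (a t) (b t)) \<longlongrightarrow> ext_rogers a0 b0) F"
proof -
  have near: "\<forall>\<^sub>F t in F. exp (f t) \<notin> \<real>\<^sub>\<le>\<^sub>0" if "(f \<longlongrightarrow> l) F" "exp l \<notin> \<real>\<^sub>\<le>\<^sub>0" for f :: "'a \<Rightarrow> complex" and l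
  proof -
    have "\<forall>\<^sub>F t in F. exp (f t) \<in> - \<real>\<^sub>\<le>\<^sub>0"
      by (intro topological_tendstoD[OF tendsto_exp[OF that(1)]])
        (use that(2) in \<open>auto simp: closed_nonpos_Reals_complex open_Compl\<close>)
    then show ?thesis by simp
  qed
  have lim: "((\<lambda>t. rogers_exp (f t) (g t)) \<longlongrightarrow> rogers_exp f0 g0) F"
    if "(f \<longlongrightarrow> f0) F" "(g \<longlongrightarrow> g0) F" "exp f0 + exp g0 = 1" "exp g0 \<notin> \<real>\<^sub>\<le>\<^sub>0" for f f0 g g0
  proof -
    have "1 - exp f0 = exp g0" using that by (simp add: algebra_simps)
    then have "((\<lambda>t. dilog (exp (f t))) \<longlongrightarrow> dilog (exp f0)) F"
      using that by (intro isCont_tendsto_compose[OF isCont_dilog] tendsto_intros) auto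
    then show ?thesis
      unfolding rogers_exp_def using that by (intro tendsto_intros) auto
  qed
  from sum0 show ?thesis
  proof (cases rule: exp_sum_1_cases)
    case 1
    have "((\<lambda>t. inverse (rogers_exp (b t) (a t))) \<longlongrightarrow> inverse (rogers_exp b0 a0)) F"
      using sum0 1 by (intro tendsto_inverse lim a b) (auto simp: rogers_exp_def add.commute)
    moreover have "\<forall>\<^sub>F t in F. inverse (rogers_exp (b t) (a t)) = ext_rogers (a t) (b t)"
      using near[OF a 1] sum by eventually_elim (simp add: ext_rogers_eq_inverse)
    ultimately show ?thesis
      using ext_rogers_eq_inverse[OF sum0 1] Lim_transform_eventually by force
  next
    case 2
    have "\<forall>\<^sub>F t in F. rogers_exp (a t) (b t) = ext_rogers (a t) (b t)"
      using near[OF b 2] by eventually_elim (simp add: ext_rogers_eq_rogers_exp)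
    with lim[OF a b sum0 2] show ?thesis
      using ext_rogers_eq_rogers_exp[OF 2] Lim_transform_eventually by force
  qed
qed

text \<open>The degenerate limit x = exp a tending to 0. Since \<open>b\<close> tends to 0 it is the
  principal logarithm of 1 - x, hence O(x), while \<open>a\<close> grows like log x because its
  imaginary part is bounded. So \<open>a * b\<close> tends to 0, and so does
  \<open>dilog x\<close>.\<close>

lemma tendsto_ext_rogers_1:
  assumes b: "(b \<longlongrightarrow> 0) F" and Im: "\<forall>\<^sub>F t in F. \<bar>Im (a t)\<bar> \<le> K"
    and sum: "\<forall>\<^sub>F t in F. exp (a t) + exp (b t) = 1"
  shows "((\<lambda>t. ext_rogers (a t) (b t)) \<longlongrightarrow> 1) F"
proof -
  have "((\<lambda>t. 1 - exp (b t)) \<longlongrightarrow> 1 - exp 0) F" by (intro tendsto_intros b)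
  moreover have sum': "\<forall>\<^sub>F t in F. 1 - exp (b t) = exp (a t)"
    using sum by eventually_elim (simp add: algebra_simps)
  ultimately have ea: "((\<lambda>t. exp (a t)) \<longlongrightarrow> 0) F"
    by (simp add: tendsto_cong)
  have smallb: "\<forall>\<^sub>F t in F. norm (b t) < 1"
    using tendsto_norm[OF b] by (intro order_tendstoD) auto
  have smalla: "\<forall>\<^sub>F t in F. norm (exp (a t)) < 1/2"
    using tendsto_norm[OF ea] by (intro order_tendstoD) auto
  \<comment> \<open>With r = |exp a| this is the bound for |a| times the bound 2 r for |b|.\<close>
  have "((\<lambda>r::real. (\<bar>ln r\<bar> + K) * (2 * r)) \<longlongrightarrow> 0) (at_right 0)" by real_asymp
  moreover have "filterlim (\<lambda>t. norm (exp (a t))) (at_right 0) F"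
    using tendsto_norm[OF ea] by (auto simp: filterlim_at)
  ultimately have "((\<lambda>t. (\<bar>ln (norm (exp (a t)))\<bar> + K) * (2 * norm (exp (a t)))) \<longlongrightarrow> 0) F"
    by (rule filterlim_compose)
  moreover have "\<forall>\<^sub>F t in F. norm (a t * b t) \<le>
      (\<bar>ln (norm (exp (a t)))\<bar> + K) * (2 * norm (exp (a t)))"
    using Im sum' smalla smallb
  proof eventually_elim
    case (elim t)
    have "b t = Ln (exp (b t))"
      using abs_Im_le_cmod[of "b t"] elim pi_gt3 by (intro Ln_exp[symmetric]) auto
    also have "\<dots> = Ln (1 + - exp (a t))" using elim by (simp flip: elim(2))
    finally have "norm (b t) \<le> 2 * norm (exp (a t))"
      using norm_Ln_le[of "- exp (a t)"] elim by simp
    moreover have "norm (a t) \<le> \<bar>ln (norm (exp (a t)))\<bar> + K"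
      using cmod_le[of "a t"] elim by simp
    ultimately show ?case unfolding norm_mult
      using order_trans[OF norm_ge_zero] by (intro mult_mono) auto
  qed
  ultimately have ab: "((\<lambda>t. a t * b t) \<longlongrightarrow> 0) F"
    by (rule Lim_null_comparison[rotated])
  have "((\<lambda>t. dilog (exp (a t))) \<longlongrightarrow> dilog 0) F"
    by (rule isCont_tendsto_compose[OF isCont_dilog ea]) (simp add: complex_nonpos_Reals_iff)
  then have "((\<lambda>t. exp (12 / (of_real pi * \<i>) * (dilog (exp (a t)) + a t * b t / 2)))
      \<longlongrightarrow> exp (12 / (of_real pi * \<i>) * (dilog 0 + 0 / 2))) F"
    by (intro tendsto_intros ab) auto
  moreover have "\<forall>\<^sub>F t in F. exp (12 / (of_real pi * \<i>) * (dilog (exp (a t)) + a t * b t / 2))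
      = ext_rogers (a t) (b t)"
    using sum' smalla smallb
  proof eventually_elim
    case (elim t)
    have "Ln (exp (b t)) = b t"
      using abs_Im_le_cmod[of "b t"] elim pi_gt3 by (intro Ln_exp) auto
    moreover have "exp (b t) = 1 - exp (a t)" using elim(1) by (simp add: algebra_simps)
    then have "exp (b t) \<notin> \<real>\<^sub>\<le>\<^sub>0"
      using elim(2) complex_Re_le_cmod[of "exp (a t)"]
      by (auto simp: complex_nonpos_Reals_iff)
    ultimately show ?case by (simp add: ext_rogers_eq_rogers_exp rogers_exp_def algebra_simps)
  qed
  ultimately show ?thesis by (simp add: tendsto_cong)
qed

section \<open>Computations in the exterior square\<close>

lemma wedge_0_left [simp]: "0 \<and>\<^sub>Z b = 0"
  using wedge_add_left[of 0 0 b] by simp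

lemma wedge_0_right [simp]: "a \<and>\<^sub>Z 0 = 0"
  using wedge_add_right[of a 0 0] by simp

lemma wedge_minus_left: "(- a) \<and>\<^sub>Z b = - (a \<and>\<^sub>Z b)"
  using wedge_add_left[of a "- a" b] by (simp add: eq_neg_iff_add_eq_0 add.commute)

lemma wedge_minus_right: "a \<and>\<^sub>Z (- b) = - (a \<and>\<^sub>Z b)"
  using wedge_add_right[of a b "- b"] by (simp add: eq_neg_iff_add_eq_0 add.commute)

lemma wedge_diff_left: "(a - a') \<and>\<^sub>Z b = a \<and>\<^sub>Z b - a' \<and>\<^sub>Z b"
  using wedge_add_left[of a "- a'" b] by (simp add: wedge_minus_left)

lemma wedge_diff_right: "a \<and>\<^sub>Z (b - b') = a \<and>\<^sub>Z b - a \<and>\<^sub>Z b'"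
  using wedge_add_right[of a b "- b'"] by (simp add: wedge_minus_right)

lemma wedge_swap: "a \<and>\<^sub>Z b = - (b \<and>\<^sub>Z a)"
proof -
  have "a \<and>\<^sub>Z a + b \<and>\<^sub>Z a + (a \<and>\<^sub>Z b + b \<and>\<^sub>Z b) = 0"
    unfolding wedge_add_left[symmetric] wedge_add_right[symmetric] by (rule wedge_self)
  then show ?thesis by (simp add: wedge_self eq_neg_iff_add_eq_0 add.commute)
qed

lemma wedge_of_int_mult:
  fixes a b :: "'a::ring_1"
  shows "(of_int k * a) \<and>\<^sub>Z b = a \<and>\<^sub>Z (of_int k * b)"
proof (induction k rule: int_induct[where k = 0])
  case (step1 i)
  then show ?case by (simp add: distrib_right wedge_add_left wedge_add_right)
next
  case (step2 i)
  then show ?case by (simp add: left_diff_distrib wedge_diff_left wedge_diff_right)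
qed simp

lemma wedge_of_int_mult_self [simp]:
  fixes a :: "'a::ring_1"
  shows "a \<and>\<^sub>Z (of_int k * a) = 0"
proof (induction k rule: int_induct[where k = 0])
  case (step1 i)
  then show ?case by (simp add: distrib_right wedge_add_right wedge_self)
next
  case (step2 i)
  then show ?case by (simp add: left_diff_distrib wedge_diff_right wedge_self)
qed simp

text \<open>Both arguments are integer multiples of \<open>a / n\<close>.\<close>

lemma wedge_rational_multiple:
  fixes a :: "'a::field_char_0"
  assumes "n \<noteq> 0"
  shows "a \<and>\<^sub>Z (of_int k / of_int n * a) = 0"
proof -
  have "a \<and>\<^sub>Z (of_int k / of_int n * a) = (of_int n * (a / of_int n)) \<and>\<^sub>Z (of_int k * (a / of_int n))"
    using assms by simp
  also have "\<dots> = (a / of_int n) \<and>\<^sub>Z (of_int (n * k) * (a / of_int n))"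
    unfolding wedge_of_int_mult by (simp add: mult.assoc)
  also have "\<dots> = 0" by (rule wedge_of_int_mult_self)
  finally show ?thesis .
qed

text \<open>Writing b = 2 (b/2) moves the factor 1/2 to the other argument, so halving one argument
  keeps the wedge antisymmetric.\<close>

lemma half_wedge_swap:
  fixes a b :: "'a::field_char_0"
  shows "(1/2 * a) \<and>\<^sub>Z b = - ((1/2 * b) \<and>\<^sub>Z a)"
proof -
  have "(1/2 * a) \<and>\<^sub>Z b = (1/2 * a) \<and>\<^sub>Z (of_int 2 * (1/2 * b))" by simp
  also have "\<dots> = a \<and>\<^sub>Z (1/2 * b)" by (subst wedge_of_int_mult[symmetric]) simp
  finally show ?thesis using wedge_swap by metis
qed

lemma half_wedge_self:
  fixes a :: "'a::field_char_0"
  shows "(1/2 * a) \<and>\<^sub>Z a = 0"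
proof -
  have "(1/2 * a) \<and>\<^sub>Z a = (1/2 * a) \<and>\<^sub>Z (of_int 2 * (1/2 * a))" by simp
  then show ?thesis by (simp only: wedge_of_int_mult_self)
qed

section \<open>The map \<open>p2\<close> in terms of chosen logarithms\<close>

text \<open>A path-free form of \<open>p2_along\<close>: \<open>a\<close> and \<open>b\<close> stand
  for log x and log (1 - x), and \<open>q\<close> for the value of L_2.\<close>

definition p2_value :: "complex \<Rightarrow> complex \<Rightarrow> complex \<Rightarrow> complex exterior_square" where
  "p2_value a b q = (1/2 * b) \<and>\<^sub>Z a +
     (2 * of_real pi * \<i>) \<and>\<^sub>Z (1 / (2 * of_real pi * \<i>) * q)"

text \<open>The kernel of \<open>q \<mapsto> 2 \<pi> i \<and> q / (2 \<pi> i)\<close> contains \<open>(2 \<pi> i)\<^sup>2 \<rat>\<close>, so the second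
  summand only depends on a suitable exponential of \<open>q\<close>.\<close>

lemma wedge_2pi_i_eq_0:
  assumes "exp (12 / (of_real pi * \<i>) * q) = 1"
  shows "(2 * of_real pi * \<i>) \<and>\<^sub>Z (1 / (2 * of_real pi * \<i>) * q) = 0"
proof -
  have "exp (12 / (of_real pi * \<i>) * q) = exp 0" using assms by simp
  then obtain k where k: "12 / (of_real pi * \<i>) * q = complex_of_real (real_of_int (2 * k) * pi) * \<i>"
    unfolding exp_eq by auto
  have "1 / (2 * of_real pi * \<i>) * q = 12 / (of_real pi * \<i>) * q / 24"
    by (simp add: field_simps)
  also have "\<dots> = of_int k / of_int 24 * (2 * of_real pi * \<i>)"
    unfolding k by simp
  finally have eq: "1 / (2 * of_real pi * \<i>) * q = of_int k / of_int 24 * (2 * of_real pi * \<i>)" .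
  show ?thesis unfolding eq by (rule wedge_rational_multiple) simp
qed

text \<open>With \<open>a\<close> and \<open>b\<close> shifted by \<open>m\<close> and
  \<open>n\<close> periods, \<open>ext_rogers_shift\<close> forces q' - q = (m b - n a)/2 * 2 pi i
  modulo integer multiples of (2 pi i)^2/24. The second summand thus gains 2 pi i wedge (m b - n
  a)/2, which is what the first one loses.\<close>

lemma p2_value_well_defined:
  assumes sum: "exp a + exp b = 1" and e: "exp a' = exp a" "exp b' = exp b"
    and q: "exp (12 / (of_real pi * \<i>) * q) = ext_rogers a b"
    and q': "exp (12 / (of_real pi * \<i>) * q') = ext_rogers a' b'"
  shows "p2_value a' b' q' = p2_value a b q"
proof -
  let ?w = "2 * complex_of_real pi * \<i>"
  obtain m where m: "a' = a + of_int m * ?w"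
    using e(1) unfolding exp_eq by (auto simp: algebra_simps)
  obtain n where n: "b' = b + of_int n * ?w"
    using e(2) unfolding exp_eq by (auto simp: algebra_simps)
  \<comment> \<open>The deviation of q' from its predicted value; its exponential is 1, so it is
    invisible in the exterior square.\<close>
  define r where "r = q' - q - 1/2 * (of_int m * b - of_int n * a) * ?w"
  have "12 / (of_real pi * \<i>) * r = 12 / (of_real pi * \<i>) * q' - 12 / (of_real pi * \<i>) * q
      - 12 * (of_int m * b - of_int n * a)"
    by (simp add: r_def field_simps)
  then have "exp (12 / (of_real pi * \<i>) * r) = 1"
    by (simp only: exp_diff q q' ext_rogers_shift[OF sum m n]) simp
  from wedge_2pi_i_eq_0[OF this] have "?w \<and>\<^sub>Z (1 / ?w * r) = 0" .
  moreover have "1 / ?w * r =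
      1 / ?w * q' - 1 / ?w * q - (of_int m * (1/2 * b) - of_int n * (1/2 * a))"
    by (simp add: r_def right_diff_distrib diff_divide_distrib mult.commute)
  ultimately have "?w \<and>\<^sub>Z (1 / ?w * q') = ?w \<and>\<^sub>Z (1 / ?w * q)
      + (?w \<and>\<^sub>Z (of_int m * (1/2 * b)) - ?w \<and>\<^sub>Z (of_int n * (1/2 * a)))"
    by (simp only: wedge_diff_right) (simp add: algebra_simps)
  moreover have "(1/2 * b') \<and>\<^sub>Z a' = (1/2 * b) \<and>\<^sub>Z a
      - (?w \<and>\<^sub>Z (of_int m * (1/2 * b)) - ?w \<and>\<^sub>Z (of_int n * (1/2 * a)))"
  proof -
    \<comment> \<open>The wedge of two periods: both arguments are integer multiples of half a
      period.\<close>
    have "(1/2 * (of_int n * ?w)) \<and>\<^sub>Z (of_int m * ?w) = 0"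
    proof -
      have "(1/2 * (of_int n * ?w)) \<and>\<^sub>Z (of_int m * ?w) = (of_int n * (1/2 * ?w)) \<and>\<^sub>Z (of_int m * ?w)"
        by (simp add: mult_ac)
      also have "\<dots> = (1/2 * ?w) \<and>\<^sub>Z (of_int (2 * n * m) * (1/2 * ?w))"
        unfolding wedge_of_int_mult by (simp add: mult_ac)
      also have "\<dots> = 0" by (rule wedge_of_int_mult_self)
      finally show ?thesis .
    qed
    moreover have "(1/2 * b) \<and>\<^sub>Z (of_int m * ?w) = - (?w \<and>\<^sub>Z (of_int m * (1/2 * b)))"
      by (subst wedge_swap) (simp only: wedge_of_int_mult)
    moreover have "(1/2 * (of_int n * ?w)) \<and>\<^sub>Z a = ?w \<and>\<^sub>Z (of_int n * (1/2 * a))"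
      by (subst half_wedge_swap, subst wedge_swap) (simp only: wedge_of_int_mult minus_minus)
    ultimately show ?thesis
      unfolding m n by (simp only: distrib_left wedge_add_left wedge_add_right) simp
  qed
  ultimately show ?thesis by (simp add: p2_value_def)
qed

section \<open>The five term relation modulo periods\<close>

text \<open>Pigeonhole: each nonzero \<open>u\<close> is a negative multiple of at most one of the
  four directions 1, -1, i, -i, and there are only three values to avoid.\<close>

lemma exists_direction_avoiding_nonpos_Reals:
  fixes u1 u2 u3 :: complex
  assumes "u1 \<noteq> 0" "u2 \<noteq> 0" "u3 \<noteq> 0"
  obtains w where "w \<noteq> 0" "\<forall>u\<in>{u1, u2, u3}. u / w \<notin> \<real>\<^sub>\<le>\<^sub>0"
proof -
  have "\<exists>w\<in>{1, -1, \<i>, -\<i>}. \<forall>u\<in>{u1, u2, u3}. u / w \<notin> \<real>\<^sub>\<le>\<^sub>0"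
    using assms by (auto simp: complex_nonpos_Reals_iff complex_eq_iff)
  then obtain w where "w \<in> {1, -1, \<i>, -\<i>}" "\<forall>u\<in>{u1, u2, u3}. u / w \<notin> \<real>\<^sub>\<le>\<^sub>0" by blast
  then show ?thesis by (intro that[of w]) auto
qed

lemma nonpos_Reals_add_of_real:
  "u \<notin> \<real>\<^sub>\<le>\<^sub>0 \<Longrightarrow> s \<ge> 0 \<Longrightarrow> u + complex_of_real s \<notin> \<real>\<^sub>\<le>\<^sub>0"
  by (auto simp: complex_nonpos_Reals_iff)

lemma tendsto_Ln_add_minus_ln: "((\<lambda>s. Ln (u + of_real s) - of_real (ln s)) \<longlongrightarrow> 0) at_top"
proof -
  have "((\<lambda>s. 1 + u * complex_of_real (1 / s)) \<longlongrightarrow> 1 + u * of_real 0) at_top"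
    by (intro tendsto_intros) real_asymp
  then have lim: "((\<lambda>s. 1 + u * complex_of_real (1 / s)) \<longlongrightarrow> 1) at_top" by simp
  then have "((\<lambda>s. Ln (1 + u * complex_of_real (1 / s))) \<longlongrightarrow> Ln 1) at_top"
    by (intro tendsto_Ln) auto
  moreover have "\<forall>\<^sub>F s in at_top. 1 + u * complex_of_real (1 / s) \<noteq> 0"
    using tendsto_imp_eventually_ne[OF lim] by simp
  then have "\<forall>\<^sub>F s in at_top.
      Ln (1 + u * complex_of_real (1 / s)) = Ln (u + of_real s) - of_real (ln s)"
    using eventually_gt_at_top[of 0]
  proof eventually_elim
    case (elim s)
    have "u + of_real s = of_real s * (1 + u * complex_of_real (1 / s))"
      using elim by (simp add: field_simps)
    then show ?case using elim by (simp del: of_real_divide add: Ln_times_of_real Ln_of_real)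
  qed
  ultimately show ?thesis by (simp add: tendsto_cong)
qed

lemma log_has_vector_derivative_mult:
  fixes f g :: "real \<Rightarrow> 'a::real_normed_field"
  assumes "(f has_vector_derivative f s * u) (at s within S)"
    and "(g has_vector_derivative g s * v) (at s within S)"
  shows "((\<lambda>s. f s * g s) has_vector_derivative (f s * g s) * (u + v)) (at s within S)"
  using has_vector_derivative_mult[OF assms] by (simp add: algebra_simps)

text \<open>\<open>pij\<close> is a logarithm of ai - aj, and each factor has the arguments log r
  and log (1 - r) for one cross-ratio of the five points with the fifth at infinity; the two sides
  collect the two signs. Some choice of logarithms is enough, by
  \<open>p2_value_well_defined\<close>.\<close>

theorem ext_rogers_five_term:
  assumes "distinct [a1, a2, a3, a4]"
  obtains p12 p13 p14 p23 p24 p34 where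
    "exp p12 = a1 - a2" "exp p13 = a1 - a3" "exp p14 = a1 - a4"
    "exp p23 = a2 - a3" "exp p24 = a2 - a4" "exp p34 = a3 - a4"
    "ext_rogers (p34 - p14) (p13 - p14) * ext_rogers (p23 - p13) (p12 - p13) =
     ext_rogers (p34 - p24) (p23 - p24) * ext_rogers (p24 - p14) (p12 - p14) *
     ext_rogers (p14 + p23 - p13 - p24) (p12 + p34 - p13 - p24)"
proof -
  \<comment> \<open>The point a1 moves along the ray a1 + s w. In this direction every a1 + s w - a,
    divided by \<open>w\<close>, stays off the slit, so \<open>P a s\<close> is a smooth logarithm
    of it.\<close>
  obtain w where w: "w \<noteq> 0" "\<forall>u\<in>{a1 - a2, a1 - a3, a1 - a4}. u / w \<notin> \<real>\<^sub>\<le>\<^sub>0"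
    using exists_direction_avoiding_nonpos_Reals[of "a1 - a2" "a1 - a3" "a1 - a4"] assms by auto
  define u where "u a = (a1 - a) / w" for a
  define P where "P a s = Ln (u a + of_real s) + Ln w" for a s
  define p12 p13 p14 where "p12 = P a2" and "p13 = P a3" and "p14 = P a4"
  define p23 p24 p34 where "p23 = Ln (a2 - a3)" and "p24 = Ln (a2 - a4)" and "p34 = Ln (a3 - a4)"
  define D where "D a s = inverse (u a + of_real s)" for a s
  have slit: "u a + of_real s \<notin> \<real>\<^sub>\<le>\<^sub>0" if "a \<in> {a2, a3, a4}" "s \<ge> 0" for a s
    using w(2) that by (intro nonpos_Reals_add_of_real) (auto simp: u_def)
  have e1: "exp (P a s) = a1 + of_real s * w - a" if "a \<in> {a2, a3, a4}" "s \<ge> 0" for a s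
  proof -
    have "u a + of_real s \<noteq> 0" using slit[OF that] by auto
    then show ?thesis using w(1) by (simp add: P_def exp_add u_def field_simps)
  qed
  note e = e1[of a2, folded p12_def, simplified] e1[of a3, folded p13_def, simplified]
    e1[of a4, folded p14_def, simplified]
  have ec: "exp p23 = a2 - a3" "exp p24 = a2 - a4" "exp p34 = a3 - a4"
    using assms by (auto simp: p23_def p24_def p34_def)
  have nz: "a1 + of_real s * w - a \<noteq> 0" if "a \<in> {a2, a3, a4}" "s \<ge> 0" for a s
    using e1[OF that] by (metis exp_not_eq_zero)
  note nzs = nz[of a2, simplified] nz[of a3, simplified] nz[of a4, simplified]
  have dP: "(P a has_vector_derivative D a s) (at s within {0..})"
    if "a \<in> {a2, a3, a4}" "s \<ge> 0" for a s
  proof -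
    have "((\<lambda>s. Ln (u a + of_real s)) has_vector_derivative (0 + 1) * D a s) (at s within {0..})"
      unfolding D_def
      by (rule has_vector_derivative_field_chain[where g = Ln, OF has_field_derivative_Ln])
        (use slit[OF that] in \<open>auto intro!: derivative_eq_intros has_vector_derivative_of_real\<close>)
    then show ?thesis
      unfolding P_def using has_vector_derivative_add_const by fastforce
  qed
  note d = dP[of a2, folded p12_def, simplified] dP[of a3, folded p13_def, simplified]
    dP[of a4, folded p14_def, simplified]
  have s2: "exp (p34 - p14 s) + exp (p13 s - p14 s) = 1"
    and s4: "exp (p23 - p13 s) + exp (p12 s - p13 s) = 1"
    and s3: "exp (p24 - p14 s) + exp (p12 s - p14 s) = 1"
    and s5: "exp (p14 s + p23 - p13 s - p24) + exp (p12 s + p34 - p13 s - p24) = 1"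
    if "s \<ge> 0" for s
    using that nzs[of s] assms
    by (simp_all add: exp_diff exp_add e ec divide_simps) (simp_all add: algebra_simps)
  have s1: "exp (p34 - p24) + exp (p23 - p24) = 1"
    using assms by (simp add: exp_diff ec divide_simps)
  \<comment> \<open>The factors with negative sign enter with swapped arguments, that is, inverted.
    The factor of \<open>p34 - p24\<close> does not involve a1 and is left out of
    \<open>G\<close>.\<close>
  define E2 where "E2 s = ext_rogers (p34 - p14 s) (p13 s - p14 s)" for s
  define E4 where "E4 s = ext_rogers (p23 - p13 s) (p12 s - p13 s)" for s
  define E3 where "E3 s = ext_rogers (p12 s - p14 s) (p24 - p14 s)" for s
  define E5 where
    "E5 s = ext_rogers (p12 s + p34 - p13 s - p24) (p14 s + p23 - p13 s - p24)" for s
  define G where "G s = E2 s * E4 s * E3 s * E5 s" for s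
  have "(G has_vector_derivative 0) (at s within {0..})" if s: "s \<in> {0..}" for s
  proof -
    let ?k = "6 / (of_real pi * \<i>) :: complex"
    define x y z where "x = D a2 s" and "y = D a3 s" and "z = D a4 s"
    note d' = d[of s, folded x_def y_def z_def]
    have s': "s \<ge> 0" using s by simp
    have "(E2 has_vector_derivative E2 s * (?k * ((p34 - p14 s) * (y - z) - (p13 s - p14 s) * (0 - z))))
        (at s within {0..})"
      unfolding E2_def
      by (intro has_vector_derivative_ext_rogers has_vector_derivative_diff
          has_vector_derivative_const d' s s' s2) simp
    moreover have "(E4 has_vector_derivative
        E4 s * (?k * ((p23 - p13 s) * (x - y) - (p12 s - p13 s) * (0 - y)))) (at s within {0..})"
      unfolding E4_def
      by (intro has_vector_derivative_ext_rogers has_vector_derivative_diff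
          has_vector_derivative_const d' s s' s4) simp
    moreover have "(E3 has_vector_derivative
        E3 s * (?k * ((p12 s - p14 s) * (0 - z) - (p24 - p14 s) * (x - z)))) (at s within {0..})"
      unfolding E3_def
      by (intro has_vector_derivative_ext_rogers has_vector_derivative_diff
          has_vector_derivative_const d' s s' s3[unfolded add.commute[of "exp (p24 - _)"]]) simp
    moreover have "(E5 has_vector_derivative
        E5 s * (?k * ((p12 s + p34 - p13 s - p24) * (z + 0 - y - 0)
          - (p14 s + p23 - p13 s - p24) * (x + 0 - y - 0)))) (at s within {0..})"
      unfolding E5_def
      by (intro has_vector_derivative_ext_rogers has_vector_derivative_diff has_vector_derivative_add
          has_vector_derivative_const d' s s' s5[unfolded add.commute[of "exp (p14 _ + _ - _ - _)"]]) simp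
    ultimately have "(G has_vector_derivative G s *
        (?k * ((p34 - p14 s) * (y - z) - (p13 s - p14 s) * (0 - z)) +
         ?k * ((p23 - p13 s) * (x - y) - (p12 s - p13 s) * (0 - y)) +
         ?k * ((p12 s - p14 s) * (0 - z) - (p24 - p14 s) * (x - z)) +
         ?k * ((p12 s + p34 - p13 s - p24) * (z + 0 - y - 0)
          - (p14 s + p23 - p13 s - p24) * (x + 0 - y - 0)))) (at s within {0..})"
      unfolding G_def by (intro log_has_vector_derivative_mult)
    \<comment> \<open>The logarithmic derivatives cancel as a polynomial identity in the logarithms
      and in x, y, z.\<close>
    moreover have "k * ((q34 - q14) * (y - z) - (q13 - q14) * (0 - z)) +
         k * ((q23 - q13) * (x - y) - (q12 - q13) * (0 - y)) +
         k * ((q12 - q14) * (0 - z) - (q24 - q14) * (x - z)) +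
         k * ((q12 + q34 - q13 - q24) * (z + 0 - y - 0)
          - (q14 + q23 - q13 - q24) * (x + 0 - y - 0)) = 0"
      for k q12 q13 q14 q23 q24 q34 :: complex
      by (simp add: algebra_simps)
    ultimately show ?thesis by (simp only: mult_zero_right)
  qed
  with convex_real_interval(1) have "\<exists>c. \<forall>s\<in>{0..}. G s = c"
    by (metis has_vector_derivative_zero_constant)
  then have const: "G s = G 0" if "s \<ge> 0" for s using that by (metis atLeast_iff order_refl)
  have ev: "\<forall>\<^sub>F s in at_top. (0::real) \<le> s" by (rule eventually_ge_at_top)
  have diff: "((\<lambda>s. P a s - P b s) \<longlongrightarrow> 0) at_top" for a b
    using tendsto_diff[OF tendsto_Ln_add_minus_ln[of "u a"] tendsto_Ln_add_minus_ln[of "u b"]]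
    by (simp add: P_def)
  \<comment> \<open>A bound, uniform in s, for the imaginary parts as
    \<open>tendsto_ext_rogers_1\<close> requires: principal logarithms contribute at most
    pi.\<close>
  define K where "K = pi + \<bar>Im (Ln w)\<bar> + \<bar>Im p34\<bar> + \<bar>Im p23\<bar> + \<bar>Im p24\<bar>"
  have Im: "\<forall>\<^sub>F s in at_top. \<bar>Im (q - P a s)\<bar> \<le> K"
    if "a \<in> {a2, a3, a4}" "q \<in> {p34, p23, p24}" for a q
    using ev
  proof eventually_elim
    case (elim s)
    have "u a + of_real s \<noteq> 0" using slit[OF that(1) elim] by auto
    then have "\<bar>Im (Ln (u a + of_real s))\<bar> \<le> pi"
      using mpi_less_Im_Ln[of "u a + of_real s"] Im_Ln_le_pi[of "u a + of_real s"] by simp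
    moreover have "\<bar>Im q\<bar> \<le> \<bar>Im p34\<bar> + \<bar>Im p23\<bar> + \<bar>Im p24\<bar>" using that(2) by auto
    ultimately show ?case unfolding K_def P_def by (simp add: abs_le_iff) linarith
  qed
  have "(E2 \<longlongrightarrow> 1) at_top"
    unfolding E2_def
    by (rule tendsto_ext_rogers_1[OF diff[of a3 a4, folded p13_def p14_def]
          Im[of a4 p34, folded p14_def] eventually_mono[OF ev s2]]) auto
  moreover have "(E4 \<longlongrightarrow> 1) at_top"
    unfolding E4_def
    by (rule tendsto_ext_rogers_1[OF diff[of a2 a3, folded p12_def p13_def]
          Im[of a3 p23, folded p13_def] eventually_mono[OF ev s4]]) auto
  moreover have "(E3 \<longlongrightarrow> inverse 1) at_top"
  proof -
    have "((\<lambda>s. ext_rogers (p24 - p14 s) (p12 s - p14 s)) \<longlongrightarrow> 1) at_top"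
      by (rule tendsto_ext_rogers_1[OF diff[of a2 a4, folded p12_def p14_def]
            Im[of a4 p24, folded p14_def] eventually_mono[OF ev s3]]) auto
    then have "((\<lambda>s. inverse (ext_rogers (p24 - p14 s) (p12 s - p14 s))) \<longlongrightarrow> inverse 1) at_top"
      by (intro tendsto_inverse) auto
    moreover have "\<forall>\<^sub>F s in at_top. inverse (ext_rogers (p24 - p14 s) (p12 s - p14 s)) = E3 s"
      using ev
    proof eventually_elim
      case (elim s)
      show ?case using ext_rogers_swap[OF s3[OF elim]] by (simp add: E3_def inverse_unique)
    qed
    ultimately show ?thesis by (rule Lim_transform_eventually)
  qed
  \<comment> \<open>The last cross-ratio tends to (a2 - a3)/(a2 - a4), one minus the argument of the
    constant factor. With the arguments swapped the limit is that factor itself.\<close>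
  moreover have "(E5 \<longlongrightarrow> ext_rogers (p34 - p24) (p23 - p24)) at_top"
    unfolding E5_def
  proof (rule tendsto_ext_rogers)
    show "((\<lambda>s. p12 s + p34 - p13 s - p24) \<longlongrightarrow> p34 - p24) at_top"
      using tendsto_add[OF diff[of a2 a3] tendsto_const[of "p34 - p24"]]
      by (simp add: p12_def p13_def algebra_simps)
    show "((\<lambda>s. p14 s + p23 - p13 s - p24) \<longlongrightarrow> p23 - p24) at_top"
      using tendsto_add[OF diff[of a4 a3] tendsto_const[of "p23 - p24"]]
      by (simp add: p14_def p13_def algebra_simps)
    show "\<forall>\<^sub>F s in at_top.
        exp (p12 s + p34 - p13 s - p24) + exp (p14 s + p23 - p13 s - p24) = 1"
      using ev by eventually_elim (use s5 in \<open>simp add: add.commute\<close>)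
  qed (rule s1)
  ultimately have "(G \<longlongrightarrow> 1 * 1 * inverse 1 * ext_rogers (p34 - p24) (p23 - p24)) at_top"
    unfolding G_def by (intro tendsto_mult)
  moreover have "\<forall>\<^sub>F s in at_top. G s = G 0"
    using ev by eventually_elim (rule const)
  ultimately have "((\<lambda>s::real. G 0) \<longlongrightarrow> ext_rogers (p34 - p24) (p23 - p24)) at_top"
    by (simp add: tendsto_cong)
  then have "G 0 = ext_rogers (p34 - p24) (p23 - p24)"
    by (simp add: tendsto_const_iff)
  then have fin: "E2 0 * E4 0 * E3 0 * E5 0 = ext_rogers (p34 - p24) (p23 - p24)"
    by (simp add: G_def)
  show thesis
  proof (rule that[of "p12 0" "p13 0" "p14 0" p23 p24 p34])
    \<comment> \<open>The swaps in \<open>E3\<close> and \<open>E5\<close> are undone at s = 0 to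
      bring these factors to the right-hand side.\<close>
    have "E3 0 * ext_rogers (p24 - p14 0) (p12 0 - p14 0) = 1"
      unfolding E3_def using s3[of 0] by (intro ext_rogers_swap) (simp add: add.commute)
    moreover have "E5 0 * ext_rogers (p14 0 + p23 - p13 0 - p24) (p12 0 + p34 - p13 0 - p24) = 1"
      unfolding E5_def using s5[of 0] by (intro ext_rogers_swap) (simp add: add.commute)
    moreover have "x * y = r * v * v'" if "x * y * t * t' = r" "t * v = 1" "t' * v' = 1"
      for x y t t' r v v' :: complex
    proof -
      have "r * v * v' = x * y * (t * v) * (t' * v')"
        unfolding that(1)[symmetric] by (simp only: mult_ac)
      then show ?thesis using that by simp
    qed
    ultimately show "ext_rogers (p34 - p14 0) (p13 0 - p14 0) * ext_rogers (p23 - p13 0) (p12 0 - p13 0) =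
      ext_rogers (p34 - p24) (p23 - p24) * ext_rogers (p24 - p14 0) (p12 0 - p14 0) *
      ext_rogers (p14 0 + p23 - p13 0 - p24) (p12 0 + p34 - p13 0 - p24)"
      using fin unfolding E2_def E4_def by blast
  qed (use e[of 0] ec in simp_all)
qed

section \<open>Continuation of the dilogarithm along a path\<close>

lemma continuous_on_dilog:
  assumes "continuous_on A f" "\<And>t. t \<in> A \<Longrightarrow> 1 - f t \<notin> \<real>\<^sub>\<le>\<^sub>0"
  shows "continuous_on A (\<lambda>t. dilog (f t))"
  by (rule continuous_on_compose2[OF continuous_at_imp_continuous_on assms(1),
        of "{z. 1 - z \<notin> \<real>\<^sub>\<le>\<^sub>0}"]) (use assms(2) isCont_dilog in auto)

text \<open>Near t0, continuity keeps \<open>h t - h t0\<close> within pi of 0, so \<open>h\<close>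
  is there the smooth function \<open>Ln (f t / f t0) + h t0\<close>.\<close>

lemma has_vector_derivative_continuous_log:
  fixes f h :: "real \<Rightarrow> complex"
  assumes S: "open S" "t0 \<in> S" and h: "continuous_on S h"
    and e: "\<And>t. t \<in> S \<Longrightarrow> exp (h t) = f t" and f: "(f has_vector_derivative f') (at t0)"
  shows "(h has_vector_derivative f' / f t0) (at t0)"
proof -
  have nz: "f t0 \<noteq> 0" using e[OF S(2)] by (metis exp_not_eq_zero)
  have "((\<lambda>t. Ln (f t / f t0)) has_vector_derivative f' / f t0 * inverse 1) (at t0)"
    by (rule has_vector_derivative_field_chain[where g = Ln])
      (use nz in \<open>auto intro!: has_vector_derivative_divide f derivative_eq_intros\<close>)
  then have "((\<lambda>t. Ln (f t / f t0) + h t0) has_vector_derivative f' / f t0) (at t0)"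
    using has_vector_derivative_add_const by fastforce
  moreover have "isCont h t0" using h S by (simp add: continuous_on_eq_continuous_at)
  then have "(h \<longlongrightarrow> h t0) (nhds t0)"
    by (metis filterlim_at_within_not_equal isCont_def tendsto_at_iff_tendsto_nhds)
  then have "\<forall>\<^sub>F t in nhds t0. dist (h t) (h t0) < pi"
    by (rule tendstoD) simp
  then obtain U where U: "open U" "t0 \<in> U" "\<And>t. t \<in> U \<Longrightarrow> dist (h t) (h t0) < pi"
    unfolding eventually_nhds by blast
  have "Ln (f t / f t0) + h t0 = h t" if "t \<in> U \<inter> S" for t
  proof -
    have "\<bar>Im (h t - h t0)\<bar> < pi"
      using U(3)[of t] that abs_Im_le_cmod[of "h t - h t0"] by (simp add: dist_norm)
    then have "Ln (exp (h t - h t0)) = h t - h t0" by (intro Ln_exp) auto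
    then show ?thesis using e that S by (simp add: exp_diff)
  qed
  ultimately show ?thesis
    using has_vector_derivative_transform_within_open[of _ _ t0 "U \<inter> S" h] U S by blast
qed

text \<open>\<open>g\<close> and \<open>L\<close> are continuous logarithms of 1 -
  \<open>\<gamma>\<close> and of \<open>\<gamma>\<close>. As log \<open>\<gamma>\<close> diverges at
  the start, \<open>L\<close> is controlled only on (0, 1]. \<open>T\<close> collects the corners of
  the path.\<close>

locale path_logs =
  fixes \<gamma> \<gamma>' g L :: "real \<Rightarrow> complex" and T :: "real set"
  assumes finite_T: "finite T"
    and cont: "continuous_on {0..1} \<gamma>" "continuous_on {0..1} g" "continuous_on {0<..1} L"
    and start: "\<gamma> 0 = 0" "g 0 = 0"
    and exp_g: "\<And>t. t \<in> {0..1} \<Longrightarrow> exp (g t) = 1 - \<gamma> t"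
    and exp_L: "\<And>t. t \<in> {0<..1} \<Longrightarrow> exp (L t) = \<gamma> t"
    and deriv: "\<And>t. t \<in> {0<..<1} - T \<Longrightarrow> (\<gamma> has_vector_derivative \<gamma>' t) (at t)"
begin

text \<open>\<open>- g s\<close> is the inner integral of dt/(1 - t) up to time
  \<open>s\<close>.\<close>

definition li2_integrand :: "real \<Rightarrow> complex" where
  "li2_integrand s = - g s * (1 / \<gamma> s * \<gamma>' s)"

lemma deriv_g: "t \<in> {0<..<1} - T \<Longrightarrow> (g has_vector_derivative - \<gamma>' t / (1 - \<gamma> t)) (at t)"
  by (rule has_vector_derivative_continuous_log[of "{0<..<1}"])
    (auto intro!: derivative_eq_intros deriv has_vector_derivative_diff_const
      simp: exp_g intro: continuous_on_subset[OF cont(2)])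

lemma deriv_L: "t \<in> {0<..<1} - T \<Longrightarrow> (L has_vector_derivative \<gamma>' t / \<gamma> t) (at t)"
  by (rule has_vector_derivative_continuous_log[of "{0<..<1}"])
    (auto intro!: deriv simp: exp_L intro: continuous_on_subset[OF cont(3)])

lemma sum_exp: "t \<in> {0<..1} \<Longrightarrow> exp (L t) + exp (g t) = 1"
  by (simp add: exp_L exp_g)

text \<open>The exponential of a local primitive of the integrand is prescribed by \<open>ext_rogers\<close>, so
  the primitives on overlapping charts differ by a constant in \<open>(2 \<pi> i)\<^sup>2 / 24 \<int>\<close>.\<close>

definition exp_primitive :: "real \<Rightarrow> complex" where
  "exp_primitive s = (if s = 0 then 1
     else ext_rogers (L s) (g s) * exp (- (12 / (of_real pi * \<i>) * (g s * L s / 2))))"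

text \<open>The bracket is a local primitive of the integrand:
  \<open>Ln (1 - \<gamma> t) - g t\<close> is a locally constant period correcting the principal
  branch to \<open>g\<close>.\<close>

lemma exp_primitive_chart_1:
  assumes "t \<in> {0<..1}" "exp (g t) \<notin> \<real>\<^sub>\<le>\<^sub>0"
  shows "exp_primitive t =
    exp (12 / (of_real pi * \<i>) * (dilog (\<gamma> t) + (Ln (1 - \<gamma> t) - g t) * L t))"
  using assms
  by (simp add: exp_primitive_def ext_rogers_eq_rogers_exp rogers_exp_def exp_L exp_g
      flip: exp_add) (simp add: algebra_simps add_divide_distrib diff_divide_distrib)

text \<open>Here the bracket is a local primitive by integration by parts: the terms with
  \<open>Ln (\<gamma> t)\<close> cancel in its derivative.\<close>

lemma exp_primitive_chart_0:
  assumes "t \<in> {0<..1}" "exp (L t) \<notin> \<real>\<^sub>\<le>\<^sub>0"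
  shows "exp_primitive t =
    exp (12 / (of_real pi * \<i>) * (- dilog (1 - \<gamma> t) - Ln (\<gamma> t) * g t))"
  using assms
  by (simp add: exp_primitive_def ext_rogers_eq_inverse[OF sum_exp] rogers_exp_def exp_L exp_g
      flip: exp_add exp_minus) (simp add: algebra_simps add_divide_distrib diff_divide_distrib)

lemma eventually_not_nonpos_Reals:
  assumes f: "continuous_on {0..1} f" and s: "s \<in> {0..1}" "f s \<notin> \<real>\<^sub>\<le>\<^sub>0"
  obtains d where "d > 0" "\<And>t::real. t \<in> {0..1} \<inter> ball s d \<Longrightarrow> f t \<notin> (\<real>\<^sub>\<le>\<^sub>0 :: complex set)"
proof -
  obtain e where e: "e > 0" "ball (f s) e \<subseteq> - \<real>\<^sub>\<le>\<^sub>0"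
    using s(2) closed_nonpos_Reals_complex by (metis ComplI open_Compl open_contains_ball)
  then obtain d where "d > 0" "\<forall>t\<in>{0..1}. dist t s < d \<longrightarrow> dist (f t) (f s) < e"
    using f s(1) unfolding continuous_on_iff by blast
  with e(2) show ?thesis by (intro that[of d]) (auto simp: dist_commute subset_iff)
qed

text \<open>Besides the two charts there is a special one at time 0, where \<open>L\<close>
  diverges. There \<open>g\<close> is the principal logarithm, so the period multiplying
  \<open>L\<close> vanishes and \<open>dilog\<close> of the path is a primitive up to the
  endpoint.\<close>

lemma local_primitive:
  assumes s: "s \<in> {0..1}"
  obtains d D where "d > 0"
    "\<And>u v. u \<le> v \<Longrightarrow> {u..v} \<subseteq> {0..1} \<inter> ball s d \<Longrightarrow> (li2_integrand has_integral D v - D u) {u..v}"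
    "\<And>t. t \<in> {0..1} \<inter> ball s d \<Longrightarrow> exp_primitive t = exp (12 / (of_real pi * \<i>) * D t)"
proof -
  note obtain_rule = that
  \<comment> \<open>It suffices to have \<open>D\<close> continuous, with the right derivative
    inside the interval and off the corners.\<close>
  have primI: thesis
    if d: "d > 0" and D: "continuous_on ({0..1} \<inter> ball s d) D"
      and D': "\<And>t. t \<in> {0<..<1} \<inter> ball s d - T \<Longrightarrow> (D has_vector_derivative li2_integrand t) (at t)"
      and e: "\<And>t. t \<in> {0..1} \<inter> ball s d \<Longrightarrow> exp_primitive t = exp (12 / (of_real pi * \<i>) * D t)"
    for d and D :: "real \<Rightarrow> complex"
  proof (rule obtain_rule[OF d _ e])
    fix u v :: real assume uv: "u \<le> v" "{u..v} \<subseteq> {0..1} \<inter> ball s d"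
    show "(li2_integrand has_integral D v - D u) {u..v}"
    proof (rule fundamental_theorem_of_calculus_interior_strong[OF finite_T uv(1)])
      fix t assume t: "t \<in> {u<..<v} - T"
      then have "0 \<le> u" "v \<le> 1" "t \<in> ball s d"
        using uv(1) uv(2) subsetD[OF uv(2), of t] by auto
      with t show "(D has_vector_derivative li2_integrand t) (at t)"
        by (intro D') auto
    qed (rule continuous_on_subset[OF D uv(2)])
  qed
  have c1: "continuous_on {0..1} (\<lambda>t. 1 - \<gamma> t)" by (intro continuous_intros cont)
  have sub: "{0..1} \<inter> ball s d \<subseteq> {0..1}" for d by blast
  have dilog_\<gamma>: "((\<lambda>t. dilog (\<gamma> t)) has_vector_derivative \<gamma>' t * - (Ln (1 - \<gamma> t) / \<gamma> t)) (at t)"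
    if "t \<in> {0<..<1} - T" "1 - \<gamma> t \<notin> \<real>\<^sub>\<le>\<^sub>0" for t
  proof -
    have "\<gamma> t \<noteq> 0" using that exp_L[of t] by auto
    then show ?thesis
      using has_vector_derivative_field_chain[OF has_field_derivative_dilog[OF that(2)] deriv[OF that(1)]]
      by (simp add: dilog_deriv_def)
  qed
  show thesis
  proof (cases "s = 0")
    case True
    obtain d1 where d1: "d1 > 0" "\<And>t. t \<in> {0..1} \<inter> ball s d1 \<Longrightarrow> 1 - \<gamma> t \<notin> \<real>\<^sub>\<le>\<^sub>0"
      using eventually_not_nonpos_Reals[OF c1 s] True start by auto
    obtain d2 where d2: "d2 > 0" "\<And>t. t \<in> {0..1} \<Longrightarrow> dist t s < d2 \<Longrightarrow> dist (g t) (g s) < pi"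
      using cont(2) s pi_gt_zero unfolding continuous_on_iff by blast
    have Ln_g: "Ln (1 - \<gamma> t) = g t" if "t \<in> {0..1} \<inter> ball s (min d1 d2)" for t
    proof -
      have "dist (g t) (g s) < pi" using that by (intro d2(2)) (auto simp: dist_commute)
      then have "\<bar>Im (g t)\<bar> < pi" using abs_Im_le_cmod[of "g t"] True start by simp
      then have "Ln (exp (g t)) = g t" by (intro Ln_exp) auto
      then show ?thesis using that by (simp add: exp_g)
    qed
    show thesis
    proof (rule primI)
      show "min d1 d2 > 0" using d1 d2 by simp
      show "continuous_on ({0..1} \<inter> ball s (min d1 d2)) (\<lambda>t. dilog (\<gamma> t))"
        by (intro continuous_on_dilog continuous_on_subset[OF cont(1) sub] d1) auto
      fix t assume t: "t \<in> {0..1} \<inter> ball s (min d1 d2)"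
      show "exp_primitive t = exp (12 / (of_real pi * \<i>) * dilog (\<gamma> t))"
      proof (cases "t = 0")
        case True
        then show ?thesis by (simp add: exp_primitive_def start)
      next
        case False
        then show ?thesis
          using t d1(2)[of t] exp_primitive_chart_1[of t] by (simp add: Ln_g exp_g)
      qed
    next
      fix t assume "t \<in> {0<..<1} \<inter> ball s (min d1 d2) - T"
      then show "((\<lambda>t. dilog (\<gamma> t)) has_vector_derivative li2_integrand t) (at t)"
        using dilog_\<gamma>[of t] d1(2)[of t] Ln_g[of t] by (simp add: li2_integrand_def mult.commute)
    qed
  next
    case False
    with s have s0: "s \<in> {0<..1}" by auto
    \<comment> \<open>A radius of at most \<open>s\<close> keeps the neighbourhood inside (0, 1],
      where \<open>L\<close> is continuous.\<close>
    have pos: "{0..1} \<inter> ball s d \<subseteq> {0<..1}" if "d \<le> s" for d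
      using that by (auto simp: dist_real_def)
    from sum_exp[OF s0] show thesis
    proof (cases rule: exp_sum_1_cases)
      case 2
      then have "1 - \<gamma> s \<notin> \<real>\<^sub>\<le>\<^sub>0" using s by (simp add: exp_g)
      then obtain d1 where d1: "d1 > 0" "\<And>t. t \<in> {0..1} \<inter> ball s d1 \<Longrightarrow> 1 - \<gamma> t \<notin> \<real>\<^sub>\<le>\<^sub>0"
        using eventually_not_nonpos_Reals[OF c1 s] by blast
      let ?d = "min d1 s"
      show thesis
      proof (rule primI)
        show "?d > 0" using d1 s0 by simp
        show "continuous_on ({0..1} \<inter> ball s ?d) (\<lambda>t. dilog (\<gamma> t) + (Ln (1 - \<gamma> t) - g t) * L t)"
          by (intro continuous_intros continuous_on_dilog continuous_on_Ln d1(2)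
              continuous_on_subset[OF cont(1) sub] continuous_on_subset[OF cont(2) sub]
              continuous_on_subset[OF cont(3) pos]) auto
        fix t assume t: "t \<in> {0..1} \<inter> ball s ?d"
        then have "t \<in> {0<..1}" using pos[of ?d] by auto
        then show "exp_primitive t =
            exp (12 / (of_real pi * \<i>) * (dilog (\<gamma> t) + (Ln (1 - \<gamma> t) - g t) * L t))"
          using t d1(2)[of t] by (intro exp_primitive_chart_1) (simp_all add: exp_g)
      next
        fix t assume t: "t \<in> {0<..<1} \<inter> ball s ?d - T"
        then have t': "t \<in> {0<..<1} - T" and sl: "1 - \<gamma> t \<notin> \<real>\<^sub>\<le>\<^sub>0" using d1(2)[of t] by auto
        have nz: "\<gamma> t \<noteq> 0" "1 - \<gamma> t \<noteq> 0" using t' exp_L[of t] exp_g[of t] by auto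
        have "((\<lambda>t. Ln (1 - \<gamma> t)) has_vector_derivative (0 - \<gamma>' t) * inverse (1 - \<gamma> t)) (at t)"
          by (intro has_vector_derivative_field_chain[where g = Ln] has_field_derivative_Ln sl
              has_vector_derivative_diff has_vector_derivative_const deriv t')
        then have "((\<lambda>t. dilog (\<gamma> t) + (Ln (1 - \<gamma> t) - g t) * L t) has_vector_derivative
            \<gamma>' t * - (Ln (1 - \<gamma> t) / \<gamma> t) + ((Ln (1 - \<gamma> t) - g t) * (\<gamma>' t / \<gamma> t) +
            ((0 - \<gamma>' t) * inverse (1 - \<gamma> t) - - \<gamma>' t / (1 - \<gamma> t)) * L t)) (at t)"
          by (intro has_vector_derivative_add has_vector_derivative_mult has_vector_derivative_diff
              dilog_\<gamma> deriv_L deriv_g t' sl)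
        then show "((\<lambda>t. dilog (\<gamma> t) + (Ln (1 - \<gamma> t) - g t) * L t) has_vector_derivative
            li2_integrand t) (at t)"
          by (rule back_subst[of "\<lambda>d. (_ has_vector_derivative d) _"])
            (use nz in \<open>simp add: li2_integrand_def field_simps\<close>)
      qed
    next
      case 1
      then have "\<gamma> s \<notin> \<real>\<^sub>\<le>\<^sub>0" using s0 by (simp add: exp_L)
      then obtain d1 where d1: "d1 > 0" "\<And>t. t \<in> {0..1} \<inter> ball s d1 \<Longrightarrow> \<gamma> t \<notin> \<real>\<^sub>\<le>\<^sub>0"
        using eventually_not_nonpos_Reals[OF cont(1) s] by blast
      let ?d = "min d1 s"
      show thesis
      proof (rule primI)
        show "?d > 0" using d1 s0 by simp
        show "continuous_on ({0..1} \<inter> ball s ?d) (\<lambda>t. - dilog (1 - \<gamma> t) - Ln (\<gamma> t) * g t)"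
          using d1(2) by (intro continuous_intros continuous_on_dilog continuous_on_Ln
              continuous_on_subset[OF cont(1) sub] continuous_on_subset[OF cont(2) sub]) auto
        fix t assume t: "t \<in> {0..1} \<inter> ball s ?d"
        then have "t \<in> {0<..1}" using pos[of ?d] by auto
        then show "exp_primitive t =
            exp (12 / (of_real pi * \<i>) * (- dilog (1 - \<gamma> t) - Ln (\<gamma> t) * g t))"
          using t d1(2)[of t] by (intro exp_primitive_chart_0) (simp_all add: exp_L)
      next
        fix t assume t: "t \<in> {0<..<1} \<inter> ball s ?d - T"
        then have t': "t \<in> {0<..<1} - T" and sl: "\<gamma> t \<notin> \<real>\<^sub>\<le>\<^sub>0" using d1(2)[of t] by auto
        have nz: "\<gamma> t \<noteq> 0" "1 - \<gamma> t \<noteq> 0" using t' exp_L[of t] exp_g[of t] by auto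
        have 1: "((\<lambda>t. dilog (1 - \<gamma> t)) has_vector_derivative
            (0 - \<gamma>' t) * dilog_deriv (1 - \<gamma> t)) (at t)"
          by (intro has_vector_derivative_field_chain[where g = dilog] has_field_derivative_dilog
              has_vector_derivative_diff has_vector_derivative_const deriv t') (simp add: sl)
        have 2: "((\<lambda>t. Ln (\<gamma> t)) has_vector_derivative \<gamma>' t * inverse (\<gamma> t)) (at t)"
          by (intro has_vector_derivative_field_chain[where g = Ln] has_field_derivative_Ln sl deriv t')
        from 1 2 have "((\<lambda>t. - dilog (1 - \<gamma> t) - Ln (\<gamma> t) * g t) has_vector_derivative
            - ((0 - \<gamma>' t) * dilog_deriv (1 - \<gamma> t)) -
            (Ln (\<gamma> t) * (- \<gamma>' t / (1 - \<gamma> t)) + \<gamma>' t * inverse (\<gamma> t) * g t)) (at t)"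
          by (intro has_vector_derivative_mult has_vector_derivative_diff has_vector_derivative_minus
              deriv_g t')
        then show "((\<lambda>t. - dilog (1 - \<gamma> t) - Ln (\<gamma> t) * g t) has_vector_derivative
            li2_integrand t) (at t)"
          by (rule back_subst[of "\<lambda>d. (_ has_vector_derivative d) _"])
            (use nz in \<open>simp add: li2_integrand_def dilog_deriv_def divide_inverse algebra_simps\<close>)
      qed
    qed
  qed
qed

text \<open>Integrability on small intervals around each point suffices by compactness, and the
  local primitives provide it, also at 0.\<close>

lemma li2_integrand_integrable: "li2_integrand integrable_on {0..1}"
proof -
  have "\<exists>d>0. \<forall>u v. s \<in> {u..v} \<and> {u..v} \<subseteq> ball s d \<and> {u..v} \<subseteq> {0..1} \<longrightarrow>
      li2_integrand integrable_on {u..v}" if s: "s \<in> {0..1}" for s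
  proof -
    obtain d D where "d > 0"
      "\<And>u v. u \<le> v \<Longrightarrow> {u..v} \<subseteq> {0..1} \<inter> ball s d \<Longrightarrow> (li2_integrand has_integral D v - D u) {u..v}"
      using local_primitive[OF s] by metis
    then show ?thesis
      by (intro exI[of _ d]) (metis Int_greatest atLeastAtMost_iff has_integral_integrable order_trans)
  qed
  then show ?thesis
    using integrable_on_little_subintervals[of "0::real" 1 li2_integrand] by simp
qed

text \<open>The quotient \<open>Q\<close> is locally constant on [0, 1], because the integral and a
  local primitive differ by a constant, and it equals 1 at 0.\<close>

lemma exp_integral:
  "exp (12 / (of_real pi * \<i>) * integral {0..1} li2_integrand) = exp_primitive 1"
proof -
  let ?c = "12 / (of_real pi * \<i>)"
  define Q where "Q t = exp (?c * integral {0..t} li2_integrand) / exp_primitive t" for t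
  have int: "li2_integrand integrable_on {0..t}" if "t \<le> 1" for t
    by (rule integrable_subinterval_real[OF li2_integrand_integrable]) (use that in auto)
  have comb: "integral {0..v} li2_integrand - integral {0..u} li2_integrand = integral {u..v} li2_integrand"
    if "0 \<le> u" "u \<le> v" "v \<le> 1" for u v
    using Henstock_Kurzweil_Integration.integral_combine[of 0 u v li2_integrand] int that
    by (simp add: algebra_simps)
  have "Q 0 = Q 1"
  proof (rule connected_local_const[of "{0..1::real}"])
    show "\<forall>s\<in>{0..1}. \<forall>\<^sub>F t in at s within {0..1}. Q s = Q t"
    proof
      fix s :: real assume s: "s \<in> {0..1}"
      then obtain d D where d: "d > 0"
        and D: "\<And>u v. u \<le> v \<Longrightarrow> {u..v} \<subseteq> {0..1} \<inter> ball s d \<Longrightarrow> (li2_integrand has_integral D v - D u) {u..v}"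
        and e: "\<And>t. t \<in> {0..1} \<inter> ball s d \<Longrightarrow> exp_primitive t = exp (?c * D t)"
        using local_primitive by metis
      have Q: "Q t = exp (?c * (integral {0..t} li2_integrand - D t))" if "t \<in> {0..1} \<inter> ball s d" for t
        using e[OF that] by (simp add: Q_def right_diff_distrib exp_diff)
      have "integral {0..v} li2_integrand - D v = integral {0..u} li2_integrand - D u"
        if "u \<le> v" "u \<in> {0..1} \<inter> ball s d" "v \<in> {0..1} \<inter> ball s d" for u v
      proof -
        have "{u..v} \<subseteq> {0..1} \<inter> ball s d"
          using that by (auto simp: dist_real_def)
        from D[OF that(1) this] have "integral {u..v} li2_integrand = D v - D u"
          by (rule integral_unique)
        with comb[of u v] that show ?thesis by (simp add: algebra_simps)
      qed
      then have "Q s = Q t" if "t \<in> {0..1} \<inter> ball s d" for t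
        using that s d Q by (metis IntI centre_in_ball linear)
      then show "\<forall>\<^sub>F t in at s within {0..1}. Q s = Q t"
        using d by (auto simp: eventually_at dist_commute intro!: exI[of _ d])
    qed
  qed auto
  moreover have "Q 0 = 1" by (simp add: Q_def exp_primitive_def)
  ultimately show ?thesis by (simp add: Q_def divide_eq_1_iff)
qed

end

section \<open>Logarithms and integrals along a tangential path\<close>

text \<open>The primitive \<open>h\<close> is a function of the path parameter, so it may be a
  multivalued function of the point, such as a continued logarithm.\<close>

lemma contour_integral_subpath_primitive:
  fixes f :: "complex \<Rightarrow> complex" and \<gamma> :: "real \<Rightarrow> complex"
  assumes T: "finite T" and uv: "0 \<le> u" "u \<le> v" "v \<le> 1"
    and h: "continuous_on {u..v} h"
    and \<gamma>: "\<And>t. t \<in> {u<..<v} - T \<Longrightarrow> (\<gamma> has_vector_derivative \<gamma>' t) (at t)"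
    and h': "\<And>t. t \<in> {u<..<v} - T \<Longrightarrow> (h has_vector_derivative f (\<gamma> t) * \<gamma>' t) (at t)"
  shows "contour_integral (subpath u v \<gamma>) f = h v - h u"
proof (cases "u = v")
  case False
  define a where "a r = (v - u) * r + u" for r
  let ?p = "subpath u v \<gamma>"
  have inj: "inj a" using False by (auto simp: a_def inj_def)
  have a: "a r \<in> {u<..<v} - T" if "r \<in> {0<..<1} - a -` T" for r
  proof -
    have "0 < (v - u) * r" "(v - u) * r < (v - u) * 1"
      using that False uv by (auto intro!: mult_pos_pos mult_strict_left_mono simp del: mult_1_right)
    then show ?thesis using that by (auto simp: a_def)
  qed
  have a': "(a has_vector_derivative v - u) (at r)" for r
    unfolding a_def by (auto intro!: derivative_eq_intros simp: has_real_derivative_iff_has_vector_derivative[symmetric])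
  have vd: "vector_derivative ?p (at r within {0..1}) = (v - u) *\<^sub>R \<gamma>' (a r)"
    if "r \<in> {0<..<1} - a -` T" for r
  proof (rule vector_derivative_at_within_ivl)
    show "(?p has_vector_derivative (v - u) *\<^sub>R \<gamma>' (a r)) (at r)"
      using vector_diff_chain_at[OF a' \<gamma>[OF a[OF that]]] by (simp add: subpath_def a_def o_def)
  qed (use that in auto)
  have "((\<lambda>r. f (?p r) * vector_derivative ?p (at r within {0..1})) has_integral
      (h \<circ> a) 1 - (h \<circ> a) 0) {0..1}"
  proof (rule fundamental_theorem_of_calculus_interior_strong)
    show "finite (a -` T)" using T inj by (rule finite_vimageI)
    have "a r \<in> {u..v}" if "r \<in> {0..1}" for r
      using uv that mult_left_mono[of r 1 "v - u"] by (auto simp: a_def)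
    then have "a ` {0..1} \<subseteq> {u..v}" by blast
    then show "continuous_on {0..1} (h \<circ> a)"
      by (intro continuous_on_compose continuous_on_subset[OF h]) (auto simp: a_def intro!: continuous_intros)
    fix r assume r: "r \<in> {0<..<1} - a -` T"
    have "(h \<circ> a has_vector_derivative (v - u) *\<^sub>R (f (\<gamma> (a r)) * \<gamma>' (a r))) (at r)"
      by (rule vector_diff_chain_at[OF a' h'[OF a[OF r]]])
    then show "(h \<circ> a has_vector_derivative f (?p r) * vector_derivative ?p (at r within {0..1})) (at r)"
      using vd[OF r] by (simp add: subpath_def a_def)
  qed simp
  then have "(f has_contour_integral (h \<circ> a) 1 - (h \<circ> a) 0) ?p"
    by (simp add: has_contour_integral_def)
  then show ?thesis by (simp add: contour_integral_unique a_def)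
qed simp

text \<open>As the initial velocity is 1, \<open>\<gamma> t / t\<close> extends continuously by 1 to
  t = 0 and has a continuous logarithm \<open>k\<close> with k(0) = 0. Adding ln t gives the branch
  of log singled out by the tangential base point.\<close>

lemma tangential_path_logs:
  assumes "tangential_path \<gamma> x"
  obtains k g T where
    "path_logs \<gamma> (\<lambda>t. vector_derivative \<gamma> (at t within {0..1})) g (\<lambda>t. of_real (ln t) + k t) T"
    "continuous_on {0..1} k" "k 0 = 0"
proof -
  from assms have vp: "valid_path \<gamma>" and start: "\<gamma> 0 = 0" and fin: "\<gamma> 1 = x"
    and vel: "(\<gamma> has_vector_derivative 1) (at 0 within {0..1})"
    and avoid: "\<And>t. t \<in> {0<..1} \<Longrightarrow> \<gamma> t \<noteq> 0 \<and> \<gamma> t \<noteq> 1"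
    by (auto simp: tangential_path_def pathstart_def pathfinish_def)
  obtain T where cont: "continuous_on {0..1} \<gamma>" and T: "finite T" "\<gamma> C1_differentiable_on {0..1} - T"
    using vp by (auto simp: valid_path_def piecewise_C1_differentiable_on_def)
  have deriv: "(\<gamma> has_vector_derivative vector_derivative \<gamma> (at t within {0..1})) (at t)"
    if t: "t \<in> {0<..<1} - T" for t
  proof -
    obtain D where "\<forall>t\<in>{0..1} - T. (\<gamma> has_vector_derivative D t) (at t)"
      using T(2) unfolding C1_differentiable_on_def by blast
    with t have d: "(\<gamma> has_vector_derivative D t) (at t)" by auto
    with vector_derivative_at_within_ivl[OF d, of 0 1] t show ?thesis by simp
  qed
  define f where "f t = (if t = 0 then 1 else \<gamma> t / of_real t)" for t :: real
  have cf: "continuous_on {0..1} f"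
    unfolding continuous_on_eq_continuous_within
  proof
    fix t :: real assume t: "t \<in> {0..1}"
    show "continuous (at t within {0..1}) f"
    proof (cases "t = 0")
      case True
      have "((\<lambda>y. norm (\<gamma> y - of_real y) / norm y) \<longlongrightarrow> 0) (at 0 within {0..1})"
        using vel by (simp add: has_vector_derivative_def has_derivative_iff_norm start scaleR_conv_of_real)
      moreover have "norm (\<gamma> y - of_real y) / norm y = norm (f y - 1)" if "y \<noteq> 0" for y
      proof -
        have "f y - 1 = (\<gamma> y - of_real y) / of_real y" using that by (simp add: f_def field_simps)
        then show ?thesis by (simp add: norm_divide)
      qed
      then have "\<forall>\<^sub>F y in at 0 within {0..1}. norm (\<gamma> y - of_real y) / norm y = norm (f y - 1)"
        unfolding eventually_at_filter by (intro always_eventually allI impI)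
      ultimately have "((\<lambda>y. norm (f y - 1)) \<longlongrightarrow> 0) (at 0 within {0..1})"
        by (rule Lim_transform_eventually)
      then have "(f \<longlongrightarrow> 1) (at 0 within {0..1})"
        by (simp add: tendsto_norm_zero_iff LIM_zero_iff)
      then show ?thesis using True by (simp add: continuous_within f_def)
    next
      case False
      have "continuous (at t within {0..1}) (\<lambda>t. \<gamma> t / of_real t)"
        using cont t False by (intro continuous_intros) (auto simp: continuous_on_eq_continuous_within)
      moreover have "\<forall>s\<in>{0..1}. dist s t < t \<longrightarrow> \<gamma> s / of_real s = f s"
        using False by (auto simp: f_def dist_real_def)
      ultimately show ?thesis
        using t False continuous_transform_within[of t "{0..1}" "\<lambda>t. \<gamma> t / of_real t" t f] by auto
    qed
  qed
  have fnz: "f t \<noteq> 0" if "t \<in> {0..1}" for t using avoid[of t] that by (auto simp: f_def)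
  have contr: "contractible {0..1::real}" by (intro convex_imp_contractible) simp
  obtain k0 where k0: "continuous_on {0..1} k0" "\<And>t. t \<in> {0..1} \<Longrightarrow> f t = exp (k0 t)"
    using continuous_logarithm_on_contractible[OF cf contr fnz] by blast
  have "continuous_on {0..1} (\<lambda>t. 1 - \<gamma> t)" by (intro continuous_intros cont)
  moreover have "1 - \<gamma> t \<noteq> 0" if "t \<in> {0..1}" for t
    using avoid[of t] that start by (cases "t = 0") auto
  ultimately obtain g0 where g0: "continuous_on {0..1} g0" "\<And>t. t \<in> {0..1} \<Longrightarrow> 1 - \<gamma> t = exp (g0 t)"
    using continuous_logarithm_on_contractible[OF _ contr] by metis
  define k where "k t = k0 t - k0 0" for t
  define g where "g t = g0 t - g0 0" for t
  have k: "continuous_on {0..1} k" "k 0 = 0" unfolding k_def by (auto intro!: continuous_intros k0)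
  have "exp (k t) = f t" if "t \<in> {0..1}" for t
    using k0(2)[of t] k0(2)[of 0] that by (simp add: k_def exp_diff f_def)
  then have expk: "exp (of_real (ln t) + k t) = \<gamma> t" if "t \<in> {0<..1}" for t
    using that by (simp add: exp_add f_def exp_of_real)
  have "path_logs \<gamma> (\<lambda>t. vector_derivative \<gamma> (at t within {0..1})) g (\<lambda>t. of_real (ln t) + k t) T"
  proof
    show "continuous_on {0..1} g" unfolding g_def by (intro continuous_intros g0)
    show "continuous_on {0<..1} (\<lambda>t. of_real (ln t) + k t)"
      by (intro continuous_intros continuous_on_subset[OF k(1)]) auto
    show "exp (g t) = 1 - \<gamma> t" if "t \<in> {0..1}" for t
      using g0(2)[of t] g0(2)[of 0] that start by (simp add: g_def exp_diff)
  qed (use T cont start deriv expk in \<open>auto simp: g_def\<close>)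
  from this k show ?thesis by (rule that)
qed

text \<open>The three integrals are identified with \<open>g 1\<close>, \<open>k 1\<close> and the
  integral of \<open>li2_integrand\<close>; \<open>exp_integral\<close> then gives the exponential
  of L_2.\<close>

theorem p2_along_eq_p2_value:
  assumes "tangential_path \<gamma> x"
  shows "p2_along \<gamma> = p2_value (log_along \<gamma>) (log1m_along \<gamma>) (L2_along \<gamma>)"
    and "exp (log_along \<gamma>) = x" and "exp (log1m_along \<gamma>) = 1 - x"
    and "exp (12 / (of_real pi * \<i>) * L2_along \<gamma>) = ext_rogers (log_along \<gamma>) (log1m_along \<gamma>)"
proof -
  obtain k g T where "path_logs \<gamma> (\<lambda>t. vector_derivative \<gamma> (at t within {0..1})) g (\<lambda>t. of_real (ln t) + k t) T"
    and k: "continuous_on {0..1} k" "k 0 = 0"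
    using tangential_path_logs[OF assms] by blast
  then interpret path_logs \<gamma> "\<lambda>t. vector_derivative \<gamma> (at t within {0..1})" g
    "\<lambda>t. of_real (ln t) + k t" T by blast
  have fin: "\<gamma> 1 = x" using assms by (simp add: tangential_path_def pathfinish_def)
  have int_g: "contour_integral (subpath 0 s \<gamma>) (\<lambda>t. 1 / (1 - t)) = - g s" if s: "s \<in> {0..1}" for s
  proof -
    have "contour_integral (subpath 0 s \<gamma>) (\<lambda>t. 1 / (1 - t)) = - g s - - g 0"
    proof (rule contour_integral_subpath_primitive[OF finite_T])
      fix t assume "t \<in> {0<..<s} - T"
      with s have t: "t \<in> {0<..<1} - T" by auto
      from deriv[OF t] show "(\<gamma> has_vector_derivative vector_derivative \<gamma> (at t within {0..1})) (at t)" .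
      show "((\<lambda>t. - g t) has_vector_derivative
          1 / (1 - \<gamma> t) * vector_derivative \<gamma> (at t within {0..1})) (at t)"
        using has_vector_derivative_minus[OF deriv_g[OF t]] by simp
    qed (use s in \<open>auto intro!: continuous_intros continuous_on_subset[OF cont(2)]\<close>)
    then show ?thesis by (simp add: start)
  qed
  from int_g[of 1] have g1: "log1m_along \<gamma> = g 1" by (simp add: log1m_along_def)
  \<comment> \<open>The term ln \<epsilon> cancels the divergence of L at \<epsilon>, so the
    regularised value is the limit of k(1) - k(\<epsilon>), namely k(1).\<close>
  have int_L: "contour_integral (subpath \<epsilon> 1 \<gamma>) (\<lambda>t. 1 / t) + of_real (ln \<epsilon>) = k 1 - k \<epsilon>"
    if e: "\<epsilon> \<in> {0<..<1}" for \<epsilon>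
  proof -
    have "contour_integral (subpath \<epsilon> 1 \<gamma>) (\<lambda>t. 1 / t) =
        (of_real (ln 1) + k 1) - (of_real (ln \<epsilon>) + k \<epsilon>)"
    proof (rule contour_integral_subpath_primitive[OF finite_T])
      show "continuous_on {\<epsilon>..1} (\<lambda>t. of_real (ln t) + k t)"
        by (rule continuous_on_subset[OF cont(3)]) (use e in auto)
      fix t assume "t \<in> {\<epsilon><..<1} - T"
      with e have t: "t \<in> {0<..<1} - T" by auto
      from deriv[OF t] show "(\<gamma> has_vector_derivative vector_derivative \<gamma> (at t within {0..1})) (at t)" .
      show "((\<lambda>t. of_real (ln t) + k t) has_vector_derivative
          1 / \<gamma> t * vector_derivative \<gamma> (at t within {0..1})) (at t)"
        using deriv_L[OF t] by simp
    qed (use e in auto)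
    then show ?thesis by simp
  qed
  have "(k \<longlongrightarrow> 0) (at_right 0)"
  proof -
    have "(k \<longlongrightarrow> k 0) (at 0 within {0..1})" using k(1) by (simp add: continuous_on)
    then show ?thesis using k(2) by (simp add: at_within_Icc_at_right)
  qed
  then have "((\<lambda>\<epsilon>. k 1 - k \<epsilon>) \<longlongrightarrow> k 1 - 0) (at_right 0)" by (intro tendsto_intros)
  moreover have "\<forall>\<^sub>F \<epsilon> in at_right 0. \<epsilon> \<in> {0<..<1::real}" by (rule eventually_at_right_real) simp
  then have "\<forall>\<^sub>F \<epsilon> in at_right 0.
      k 1 - k \<epsilon> = contour_integral (subpath \<epsilon> 1 \<gamma>) (\<lambda>t. 1 / t) + of_real (ln \<epsilon>)"
    by eventually_elim (simp add: int_L)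
  ultimately have "((\<lambda>\<epsilon>. contour_integral (subpath \<epsilon> 1 \<gamma>) (\<lambda>t. 1 / t) + of_real (ln \<epsilon>)) \<longlongrightarrow> k 1) (at_right 0)"
    using Lim_transform_eventually by fastforce
  then have k1: "log_along \<gamma> = k 1"
    unfolding log_along_def by (rule tendsto_Lim[OF trivial_limit_at_right_real])
  have Li2: "Li2_along \<gamma> = integral {0..1} li2_integrand"
    unfolding Li2_along_def iterated_integral_def
    by (rule integral_cong) (simp add: int_g li2_integrand_def)
  show "exp (log_along \<gamma>) = x" using exp_L[of 1] by (simp add: k1 fin)
  show "exp (log1m_along \<gamma>) = 1 - x" using exp_g[of 1] by (simp add: g1 fin)
  \<comment> \<open>The constant (2 pi i)^2/24 in L_2 contributes exactly one full period.\<close>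
  have "12 / (of_real pi * \<i>) * L2_along \<gamma> = 12 / (of_real pi * \<i>) * integral {0..1} li2_integrand
      + 12 / (of_real pi * \<i>) * (g 1 * k 1 / 2) + of_int 1 * (2 * of_real pi * \<i>)"
    unfolding L2_along_def Li2 g1 k1 by (simp add: field_simps power2_eq_square)
  then have "exp (12 / (of_real pi * \<i>) * L2_along \<gamma>) =
      exp_primitive 1 * exp (12 / (of_real pi * \<i>) * (g 1 * k 1 / 2))"
    by (simp only: exp_add exp_integral exp_2pi_i_int_times mult_1_right)
  also have "\<dots> = ext_rogers (k 1) (g 1)"
    by (simp add: exp_primitive_def exp_minus)
  finally show "exp (12 / (of_real pi * \<i>) * L2_along \<gamma>) = ext_rogers (log_along \<gamma>) (log1m_along \<gamma>)"
    by (simp add: k1 g1)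
  show "p2_along \<gamma> = p2_value (log_along \<gamma>) (log1m_along \<gamma>) (L2_along \<gamma>)"
    by (simp add: p2_along_def p2_value_def)
qed

section \<open>The five term relation for \<open>p\<^sub>2\<close>\<close>

lemma exists_tangential_path:
  assumes "x \<noteq> 0" "x \<noteq> 1"
  shows "\<exists>\<gamma>. tangential_path \<gamma> x"
proof -
  \<comment> \<open>For nonreal x the parabola t (1 + (x - 1) t) stays off the real axis for t > 0.
    For real x the added term i t^2 (t - 1) pushes it off for 0 < t < 1 without changing the
    endpoints or the initial velocity.\<close>
  define c where "c = (if Im x = 0 then \<i> else 0)"
  define \<gamma> where "\<gamma> t = of_real t * (1 + (x - 1) * of_real t + c * (of_real t * (of_real t - 1)))"
    for t :: real
  have d: "(\<gamma> has_vector_derivative 1 + 2 * (x - 1) * of_real t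
      + c * (of_real t * (3 * of_real t - 2))) (at t within S)" for t S
    unfolding \<gamma>_def
    by (auto intro!: derivative_eq_intros has_vector_derivative_of_real simp: algebra_simps)
  have "\<gamma> C1_differentiable_on {0..1}"
    unfolding C1_differentiable_on_def
    by (intro exI[of _ "\<lambda>t. 1 + 2 * (x - 1) * of_real t + c * (of_real t * (3 * of_real t - 2))"]
        conjI ballI d continuous_intros)
  then have "valid_path \<gamma>"
    unfolding valid_path_def by (rule C1_differentiable_imp_piecewise)
  moreover have "\<gamma> t \<noteq> 0 \<and> \<gamma> t \<noteq> 1" if "t \<in> {0<..1}" for t
  proof (cases "t = 1")
    case True
    then show ?thesis using assms by (simp add: \<gamma>_def)
  next
    case False
    with that have t: "0 < t" "t < 1" by auto
    show ?thesis
    proof (cases "Im x = 0")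
      case True
      have "Im (\<gamma> t) = t * (t * (t - 1))" using True by (simp add: \<gamma>_def c_def)
      then have "Im (\<gamma> t) \<noteq> 0" using t by simp
      then show ?thesis by auto
    next
      case False
      have "Im (\<gamma> t) = t * (Im x * t)" using False by (simp add: \<gamma>_def c_def)
      then have "Im (\<gamma> t) \<noteq> 0" using t False by simp
      then show ?thesis by auto
    qed
  qed
  moreover have "(\<gamma> has_vector_derivative 1) (at 0 within {0..1})" using d[of 0] by simp
  ultimately have "tangential_path \<gamma> x"
    by (simp add: tangential_path_def pathstart_def pathfinish_def \<gamma>_def)
  then show ?thesis by blast
qed

text \<open>Any logarithms of x and 1 - x may be used, whether or not they come from a common path.
  The five term relation can therefore choose them coherently.\<close>

lemma p2_along_eqI:
  assumes "tangential_path \<gamma> x" "exp a = x" "exp b = 1 - x"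
    and "exp (12 / (of_real pi * \<i>) * q) = ext_rogers a b"
  shows "p2_along \<gamma> = p2_value a b q"
  unfolding p2_along_eq_p2_value(1)[OF assms(1)]
  using p2_along_eq_p2_value(2-4)[OF assms(1)] assms(2-4)
  by (intro p2_value_well_defined) auto

lemma p2_along_unique:
  assumes "tangential_path \<gamma> x" "tangential_path \<gamma>' x"
  shows "p2_along \<gamma> = p2_along \<gamma>'"
  unfolding p2_along_eq_p2_value(1)[OF assms(2)]
  by (rule p2_along_eqI[OF assms(1) p2_along_eq_p2_value(2-4)[OF assms(2)]])

lemma p2_symbol_eq_p2_along:
  assumes "tangential_path \<gamma> x"
  shows "p2_symbol x = p2_along \<gamma>"
  unfolding p2_symbol_def
  by (rule p2_along_unique[OF someI[of "\<lambda>\<gamma>. tangential_path \<gamma> x", OF assms] assms])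

lemma p2_symbol_eqI:
  assumes "exp a = x" "exp b = 1 - x"
    and "exp (12 / (of_real pi * \<i>) * q) = ext_rogers a b"
  shows "p2_symbol x = p2_value a b q"
proof -
  have "x \<noteq> 0" "1 - x \<noteq> 0" using assms(1,2) by (metis exp_not_eq_zero)+
  then obtain \<gamma> where "tangential_path \<gamma> x" using exists_tangential_path by auto
  then show ?thesis
    using p2_along_eqI assms by (simp add: p2_symbol_eq_p2_along)
qed

section \<open>The five term relation\<close>

lemma wedge_five_term:
  fixes p12 p13 p14 p23 p24 p34 :: complex
  defines "W \<equiv> \<lambda>a b. (1/2 * b) \<and>\<^sub>Z a"
  shows "- W (p34 - p24) (p23 - p24) + W (p34 - p14) (p13 - p14) - W (p24 - p14) (p12 - p14)
    + W (p23 - p13) (p12 - p13) - W (p14 + p23 - p13 - p24) (p12 + p34 - p13 - p24) = 0"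
proof -
  have W: "W (a + b) c = W a c + W b c" "W (a - b) c = W a c - W b c"
    "W a (b + c) = W a b + W a c" "W a (b - c) = W a b - W a c" for a b c
    by (simp_all only: W_def wedge_add_left wedge_add_right wedge_diff_left wedge_diff_right
        distrib_left right_diff_distrib)
  have self: "W a a = 0" for a by (simp only: W_def half_wedge_self)
  have swap: "W b a = - W a b" for a b unfolding W_def by (rule half_wedge_swap)
  show ?thesis
    unfolding W self
    \<comment> \<open>Each of the fifteen pairs of distinct logarithms is brought into one order,
      after which the coefficients cancel.\<close>
    by (simp add: swap[of p13 p12] swap[of p14 p12] swap[of p23 p12] swap[of p24 p12] swap[of p34 p12]
        swap[of p14 p13] swap[of p23 p13] swap[of p24 p13] swap[of p34 p13] swap[of p23 p14]
        swap[of p24 p14] swap[of p34 p14] swap[of p24 p23] swap[of p34 p23] swap[of p34 p24])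
qed

text \<open>The case of the fifth point at infinity, where r(s, t, u, infinity) = (t - u)/(s -
  u).\<close>

lemma p2_symbol_five_term:
  assumes "distinct [a1, a2, a3, a4]"
  shows "- p2_symbol ((a3 - a4) / (a2 - a4)) + p2_symbol ((a3 - a4) / (a1 - a4))
    - p2_symbol ((a2 - a4) / (a1 - a4)) + p2_symbol ((a2 - a3) / (a1 - a3))
    - p2_symbol (((a1 - a4) * (a2 - a3)) / ((a1 - a3) * (a2 - a4))) = 0"
proof -
  obtain p12 p13 p14 p23 p24 p34 where
    e: "exp p12 = a1 - a2" "exp p13 = a1 - a3" "exp p14 = a1 - a4"
    "exp p23 = a2 - a3" "exp p24 = a2 - a4" "exp p34 = a3 - a4"
    and E: "ext_rogers (p34 - p14) (p13 - p14) * ext_rogers (p23 - p13) (p12 - p13) =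
     ext_rogers (p34 - p24) (p23 - p24) * ext_rogers (p24 - p14) (p12 - p14) *
     ext_rogers (p14 + p23 - p13 - p24) (p12 + p34 - p13 - p24)"
    by (rule ext_rogers_five_term[OF assms]) blast
  let ?c = "12 / (of_real pi * \<i>)" and ?w = "2 * of_real pi * \<i>"
  define q where "q a b = Ln (ext_rogers a b) / ?c" for a b
  have q: "exp (?c * q a b) = ext_rogers a b" for a b
  proof -
    have "?c * q a b = Ln (ext_rogers a b)"
      unfolding q_def by (simp add: field_simps)
    then show ?thesis by simp
  qed
  have sym: "p2_symbol x = p2_value a b (q a b)" if "exp a = x" "exp b = 1 - x" for x a b
    by (rule p2_symbol_eqI[OF that q])
  define q1 where "q1 = q (p34 - p24) (p23 - p24)"
  define q2 where "q2 = q (p34 - p14) (p13 - p14)"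
  define q3 where "q3 = q (p24 - p14) (p12 - p14)"
  define q4 where "q4 = q (p23 - p13) (p12 - p13)"
  define q5 where "q5 = q (p14 + p23 - p13 - p24) (p12 + p34 - p13 - p24)"
  note qs = q1_def q2_def q3_def q4_def q5_def
  have 1: "p2_symbol ((a3 - a4) / (a2 - a4)) = p2_value (p34 - p24) (p23 - p24) q1"
    and 2: "p2_symbol ((a3 - a4) / (a1 - a4)) = p2_value (p34 - p14) (p13 - p14) q2"
    and 3: "p2_symbol ((a2 - a4) / (a1 - a4)) = p2_value (p24 - p14) (p12 - p14) q3"
    and 4: "p2_symbol ((a2 - a3) / (a1 - a3)) = p2_value (p23 - p13) (p12 - p13) q4"
    unfolding qs using assms by (intro sym; simp add: exp_diff e field_simps)+
  have 5: "p2_symbol (((a1 - a4) * (a2 - a3)) / ((a1 - a3) * (a2 - a4))) =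
      p2_value (p14 + p23 - p13 - p24) (p12 + p34 - p13 - p24) q5"
    unfolding qs using assms
    by (intro sym) (simp_all add: exp_diff exp_add e divide_simps, simp_all add: algebra_simps)
  \<comment> \<open>The signed sum is grouped by sign, so that its exponential is the quotient of
    the two sides of the product identity \<open>E\<close>.\<close>
  have "?c * (- q1 + q2 - q3 + q4 - q5) = (?c * q2 + ?c * q4) - (?c * q1 + ?c * q3 + ?c * q5)"
    by (simp add: right_diff_distrib distrib_left del: times_divide_eq_left)
  then have "exp (?c * (- q1 + q2 - q3 + q4 - q5)) = 1"
    using E by (simp only: exp_diff exp_add qs q) simp
  then have "?w \<and>\<^sub>Z (1 / ?w * (- q1 + q2 - q3 + q4 - q5)) = 0"
    by (rule wedge_2pi_i_eq_0)
  then have "- (?w \<and>\<^sub>Z (1 / ?w * q1)) + ?w \<and>\<^sub>Z (1 / ?w * q2) - ?w \<and>\<^sub>Z (1 / ?w * q3)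
      + ?w \<and>\<^sub>Z (1 / ?w * q4) - ?w \<and>\<^sub>Z (1 / ?w * q5) = 0"
    by (simp only: right_diff_distrib distrib_left wedge_add_right wedge_diff_right
        mult_minus_right wedge_minus_right)
  moreover have "- (u1 + v1) + (u2 + v2) - (u3 + v3) + (u4 + v4) - (u5 + v5) = 0"
    if "- u1 + u2 - u3 + u4 - u5 = 0" "- v1 + v2 - v3 + v4 - v5 = 0"
    for u1 u2 u3 u4 u5 v1 v2 v3 v4 v5 :: "complex exterior_square"
  proof -
    have "- (u1 + v1) + (u2 + v2) - (u3 + v3) + (u4 + v4) - (u5 + v5) =
        (- u1 + u2 - u3 + u4 - u5) + (- v1 + v2 - v3 + v4 - v5)"
      by (simp add: algebra_simps)
    then show ?thesis by (simp only: that add_0)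
  qed
  ultimately show ?thesis
    unfolding 1 2 3 4 5 p2_value_def using wedge_five_term by blast
qed

text \<open>A Moebius transformation \<open>f\<close> moves \<open>s5\<close> to infinity; the factors \<open>c\<close> cancel in cross-ratios.\<close>

lemma pdiff_normalize:
  obtains f c where "\<And>s. s \<noteq> s5 \<Longrightarrow> pdiff s s5 = c s"
    and "\<And>s t. s \<noteq> s5 \<Longrightarrow> t \<noteq> s5 \<Longrightarrow> pdiff s t = c s * c t * (f s - f t)"
proof (cases s5)
  case Infty
  show ?thesis
  proof
    show "pdiff s s5 = -1" if "s \<noteq> s5" for s
      using that Infty by (cases s) (auto simp: pdiff_def)
    show "pdiff s t = -1 * -1 * (fst (hom_coords s) - fst (hom_coords t))"
      if "s \<noteq> s5" "t \<noteq> s5" for s t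
      using that Infty by (cases s; cases t) (auto simp: pdiff_def)
  qed
next
  case (Fin e)
  show ?thesis
  proof
    show "pdiff s s5 = pdiff s s5" for s ..
    \<comment> \<open>This is s -> 1/(e - s), with value 0 at infinity.\<close>
    let ?f = "\<lambda>s. - snd (hom_coords s) / pdiff s s5"
    show "pdiff s t = pdiff s s5 * pdiff t s5 * (?f s - ?f t)" if "s \<noteq> s5" "t \<noteq> s5" for s t
    proof -
      have "pdiff s s5 \<noteq> 0" "pdiff t s5 \<noteq> 0" using that by (auto simp: pdiff_eq_0_iff)
      then have "pdiff s s5 * pdiff t s5 * (?f s - ?f t)
          = snd (hom_coords t) * pdiff s s5 - snd (hom_coords s) * pdiff t s5"
        by (simp add: field_simps)
      also have "\<dots> = pdiff s t" by (simp add: Fin pdiff_def algebra_simps)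
      finally show ?thesis ..
    qed
  qed
qed

lemma p2_symbol_cross_ratio_five_term:
  assumes "distinct [s1, s2, s3, s4, s5]"
  shows "- p2_symbol (cross_ratio s2 s3 s4 s5) + p2_symbol (cross_ratio s1 s3 s4 s5)
    - p2_symbol (cross_ratio s1 s2 s4 s5) + p2_symbol (cross_ratio s1 s2 s3 s5)
    - p2_symbol (cross_ratio s1 s2 s3 s4) = 0"
proof -
  obtain f c where c: "\<And>s. s \<noteq> s5 \<Longrightarrow> pdiff s s5 = c s"
    and f: "\<And>s t. s \<noteq> s5 \<Longrightarrow> t \<noteq> s5 \<Longrightarrow> pdiff s t = c s * c t * (f s - f t)"
    by (rule pdiff_normalize[of s5]) blast
  have c0: "c s \<noteq> 0" if "s \<noteq> s5" for s using c[OF that] pdiff_eq_0_iff that by metis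
  have inj: "f s \<noteq> f t" if "s \<noteq> s5" "t \<noteq> s5" "s \<noteq> t" for s t
    using f[OF that(1,2)] pdiff_eq_0_iff[of s t] that(3) by auto
  have r5: "cross_ratio s t u s5 = (f t - f u) / (f s - f u)"
    if "s \<noteq> s5" "t \<noteq> s5" "u \<noteq> s5" for s t u
    using that by (simp add: cross_ratio_def c f c0)
  have r4: "cross_ratio s1 s2 s3 s4 = ((f s1 - f s4) * (f s2 - f s3)) / ((f s1 - f s3) * (f s2 - f s4))"
    using assms by (simp add: cross_ratio_def f c0)
  have "distinct [f s1, f s2, f s3, f s4]" using assms inj by auto
  from p2_symbol_five_term[OF this] show ?thesis
    using assms by (simp add: r5 r4)
qed

lemma p2_uminus: "p2 (- c) = - p2 c"
  using p2_add[of c "- c"] by (simp add: p2_def eq_neg_iff_add_eq_0 add.commute)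

lemma p2_diff: "p2 (c - d) = p2 c - p2 d"
  using p2_add[of c "- d"] by (simp add: p2_uminus)

theorem lemma1p6:
  shows "(\<forall>x::complex. x \<notin> {0, 1} \<longrightarrow>
            (\<exists>\<gamma>. tangential_path \<gamma> x) \<and>
            (\<forall>\<gamma> \<gamma>'. tangential_path \<gamma> x \<longrightarrow> tangential_path \<gamma>' x \<longrightarrow> p2_along \<gamma> = p2_along \<gamma>') \<and>
            (\<forall>\<gamma>. tangential_path \<gamma> x \<longrightarrow> p2 (frag_of x) = p2_along \<gamma>))
       \<and> (\<forall>s1 s2 s3 s4 s5 :: projective_line. distinct [s1, s2, s3, s4, s5] \<longrightarrow>
            p2 (- frag_of (cross_ratio s2 s3 s4 s5)
                + frag_of (cross_ratio s1 s3 s4 s5)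
                - frag_of (cross_ratio s1 s2 s4 s5)
                + frag_of (cross_ratio s1 s2 s3 s5)
                - frag_of (cross_ratio s1 s2 s3 s4)) = 0)"
proof (intro conjI allI impI)
  show "\<exists>\<gamma>. tangential_path \<gamma> x" if "x \<notin> {0, 1}" for x
    using that exists_tangential_path by simp
  show "p2_along \<gamma> = p2_along \<gamma>'" if "tangential_path \<gamma> x" "tangential_path \<gamma>' x" for x \<gamma> \<gamma>'
    using that by (rule p2_along_unique)
  show "p2 (frag_of x) = p2_along \<gamma>" if "tangential_path \<gamma> x" for x \<gamma>
    using that by (simp add: p2_frag_of p2_symbol_eq_p2_along)
qed (simp only: p2_add p2_diff p2_uminus p2_frag_of p2_symbol_cross_ratio_five_term)

end
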